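(* Fix $n$. Let $\mathrm{ALG}$ be an online algorithm for secretary matching with vertex arrival (cardinal setting) on $n$ vertices which is $\alpha$-competitive, i.e., on every complete graph on $n$ vertices with nonnegative edge weights its expected matching weight is at least $\alpha$ times the maximum matching weight. Then there is a randomized online algorithm $\mathrm{ALG}^o$ for the ordinal setting on $n$ vertices that matches the top two vertices together with probability at least $\alpha-O(1/n)$ (with an absolute implied constant). Moreover, at every time $t$, $\mathrm{ALG}^o$ only makes a binary decision whether to match together the two highest-ranked vertices among $v_1,\dots,v_t$, and the probability of doing so depends only on $t$ and on whether this matching is possible (i.e., $v_t$ is one of these two vertices and both are unmatched).
   Context: Cardinal setting (secretary matching with vertex arrival): vertices of a complete graph with nonnegative edge weights arrive in a uniformly random order $v_1,\dots,v_n$; upon arrival of $v_t$ the weights of its edges to $v_1,\dots,v_{t-1}$ are revealed, and the algorithm must immediately and irrevocably either match $v_t$ to a currently unmatched earlier vertex or leave it unmatched for now; the goal is to maximize the expected total weight. Ordinal setting: $n$ vertices are ranked by an unknown total ranking from 1st to $n$th (the 1st and 2nd are the top two vertices); they arrive in a uniformly random order $v_1,\dots,v_n$; upon arrival of $v_t$ the algorithm observes only the relative rank of $v_t$ among $v_1,\dots,v_t$ and must immediately and irrevocably decide whether to match it to an earlier unmatched vertex; the objective is to maximize the probability that the top two vertices are matched to each other. *)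

theory Defs
  imports "HOL-Probability.Probability" "HOL-Combinatorics.Permutations"
begin

text \<open>
  Vertices are the numbers in \<open>{..<n}\<close>; arrival times are also counted from \<open>0\<close>.
  An arrival order is a permutation \<open>\<pi>\<close> of \<open>{..<n}\<close>, where \<open>\<pi> t\<close> is the vertex arriving at time \<open>t\<close>.

  A decision sequence \<open>ds\<close> records one decision per past time: \<open>ds ! t = Some s\<close> means that the
  vertex arriving at time \<open>t\<close> was matched on arrival to the one that had arrived at time \<open>s\<close>.
  Vertices are thus known to an algorithm only through their arrival times.
\<close>

definition unmatched :: "nat option list \<Rightarrow> nat set" where
  "unmatched ds = {s. s < length ds \<and> ds ! s = None \<and> Some s \<notin> set ds}"

text \<open>
  A randomized online algorithm maps the observations at times \<open>0, \<dots>, t\<close> and its own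
  decisions at times \<open>0, \<dots>, t - 1\<close> to the distribution of its decision at time \<open>t\<close>.
\<close>

type_synonym 'o policy = "'o list \<Rightarrow> nat option list \<Rightarrow> nat option pmf"

definition online_algorithm :: "nat \<Rightarrow> 'o policy \<Rightarrow> bool" where
  "online_algorithm n A \<longleftrightarrow>
     (\<forall>os ds. length ds < n \<and> length os = Suc (length ds) \<longrightarrow>
        set_pmf (A os ds) \<subseteq> insert None (Some ` unmatched ds))"

primrec run :: "'o policy \<Rightarrow> (nat \<Rightarrow> 'o) \<Rightarrow> nat \<Rightarrow> nat option list pmf" where
  "run A obs 0 = return_pmf []"
| "run A obs (Suc t) =
     do {
       ds \<leftarrow> run A obs t;
       d \<leftarrow> A (map obs [0..<Suc t]) ds;
       return_pmf (ds @ [d])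
     }"

definition matched_edges :: "(nat \<Rightarrow> nat) \<Rightarrow> nat option list \<Rightarrow> nat set set" where
  "matched_edges \<pi> ds = {{\<pi> s, \<pi> t} |s t. t < length ds \<and> ds ! t = Some s}"

definition random_matching ::
  "nat \<Rightarrow> 'o policy \<Rightarrow> ((nat \<Rightarrow> nat) \<Rightarrow> nat \<Rightarrow> 'o) \<Rightarrow> nat set set pmf" where
  "random_matching n A obs =
     do {
       \<pi> \<leftarrow> pmf_of_set {\<pi>. \<pi> permutes {..<n}};
       ds \<leftarrow> run A (obs \<pi>) n;
       return_pmf (matched_edges \<pi> ds)
     }"


subsection \<open>Cardinal setting\<close>

definition complete_edges :: "nat \<Rightarrow> nat set set" where
  "complete_edges n = {e. e \<subseteq> {..<n} \<and> card e = 2}"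

definition matchings :: "nat \<Rightarrow> nat set set set" where
  "matchings n = {M. M \<subseteq> complete_edges n \<and> disjoint M}"

definition max_matching_weight :: "nat \<Rightarrow> (nat set \<Rightarrow> real) \<Rightarrow> real" where
  "max_matching_weight n w = Max ((\<lambda>M. \<Sum>e\<in>M. w e) ` matchings n)"

definition revealed_weights :: "(nat set \<Rightarrow> real) \<Rightarrow> (nat \<Rightarrow> nat) \<Rightarrow> nat \<Rightarrow> real list" where
  "revealed_weights w \<pi> t = map (\<lambda>s. w {\<pi> s, \<pi> t}) [0..<t]"

definition competitive :: "nat \<Rightarrow> real \<Rightarrow> real list policy \<Rightarrow> bool" where
  "competitive n \<alpha> A \<longleftrightarrow>
     (\<forall>w. (\<forall>e\<in>complete_edges n. 0 \<le> w e) \<longrightarrow>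
        measure_pmf.expectation (random_matching n A (revealed_weights w)) (\<lambda>M. \<Sum>e\<in>M. w e)
          \<ge> \<alpha> * max_matching_weight n w)"


subsection \<open>Ordinal setting\<close>

text \<open>Rank \<open>1\<close> is the best one.\<close>

definition ranking :: "nat \<Rightarrow> (nat \<Rightarrow> nat) \<Rightarrow> bool" where
  "ranking n \<rho> \<longleftrightarrow> bij_betw \<rho> {..<n} {1..n}"

definition rank_among :: "(nat \<Rightarrow> nat) \<Rightarrow> (nat \<Rightarrow> nat) \<Rightarrow> nat \<Rightarrow> nat \<Rightarrow> nat" where
  "rank_among \<rho> \<pi> t s = card {i. i \<le> t \<and> \<rho> (\<pi> i) \<le> \<rho> (\<pi> s)}"

definition relative_rank :: "(nat \<Rightarrow> nat) \<Rightarrow> (nat \<Rightarrow> nat) \<Rightarrow> nat \<Rightarrow> nat" where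
  "relative_rank \<rho> \<pi> t = rank_among \<rho> \<pi> t t"

definition success_prob :: "nat \<Rightarrow> (nat \<Rightarrow> nat) \<Rightarrow> nat policy \<Rightarrow> real" where
  "success_prob n \<rho> A =
     measure_pmf.prob (random_matching n A (relative_rank \<rho>))
       {M. {v. v < n \<and> \<rho> v \<le> 2} \<in> M}"

text \<open>The arrival times of the two highest-ranked vertices among those arriving up to time \<open>t\<close>.\<close>

definition top_two :: "(nat \<Rightarrow> nat) \<Rightarrow> (nat \<Rightarrow> nat) \<Rightarrow> nat \<Rightarrow> nat set" where
  "top_two \<rho> \<pi> t = {s. s \<le> t \<and> rank_among \<rho> \<pi> t s \<le> 2}"

text \<open>
  At time \<open>t\<close>, conditionally on the whole history, the algorithm matches the two currently
  highest-ranked vertices with probability \<open>p t\<close> if this is possible, and does nothing otherwise.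
\<close>

definition top_two_binary :: "nat \<Rightarrow> (nat \<Rightarrow> real) \<Rightarrow> nat policy \<Rightarrow> bool" where
  "top_two_binary n p A \<longleftrightarrow>
     (\<forall>t<n. 0 \<le> p t \<and> p t \<le> 1) \<and>
     (\<forall>\<rho> \<pi> t ds. ranking n \<rho> \<and> \<pi> permutes {..<n} \<and> t < n \<and> length ds = t \<longrightarrow>
        (\<forall>s\<in>unmatched ds. top_two \<rho> \<pi> t = {s, t} \<longrightarrow>
           A (map (relative_rank \<rho> \<pi>) [0..<Suc t]) ds =
             map_pmf (\<lambda>b. if b then Some s else None) (bernoulli_pmf (p t))) \<and>
        ((\<nexists>s. s \<in> unmatched ds \<and> top_two \<rho> \<pi> t = {s, t}) \<longrightarrow>
           A (map (relative_rank \<rho> \<pi>) [0..<Suc t]) ds = return_pmf None))"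

end

theory Submission imports Defs "HOL-Library.Ramsey" begin

text \<open>
  In the ordinal problem only the current best vertex (the leader) matters: the top pair after an
  arrival that changes it always consists of the newcomer and the previous leader. So the state is
  whether the leader is free, matched within the current top pair, or matched outside of it, and
  since the relative ranks are independent, backward induction over these three states gives the
  optimal success probability, attained by a policy that decides by \<open>t\<close> alone.

  Conversely, give the vertices \<open>0, 1, \<dots>\<close>, listed from best to worst, increasing natural values
  \<open>y v\<close>, and give the edge \<open>{u, v}\<close> the weight
  \<open>q ^ (y u + y v)\<close> with \<open>q = 1 / n\<^sup>2\<close>. All other edges of a matching together contribute at most a
  fraction \<open>1 / n\<close> of the weight of the top edge, so an \<open>\<alpha>\<close>-competitive algorithm matches the
  top pair with probability at least \<open>\<alpha> - 1 / n\<close>. By Ramsey's theorem the values can be chosen such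
  that its decision probabilities, rounded down to multiples of \<open>1 / n\<^sup>3\<close>, depend only on relative
  ranks; hence it beats the ordinal optimum by at most \<open>1 / n\<close>.
\<close>

subsection \<open>Order patterns\<close>

lemma sorted_list_of_set_nth_card_less:
  fixes x :: "'a::linorder"
  assumes "finite S" "x \<in> S"
  shows "sorted_list_of_set S ! card {z \<in> S. z < x} = x"
proof -
  define zs where "zs = sorted_list_of_set S"
  have zs: "sorted_wrt (<) zs" "set zs = S"
    using assms by (simp_all add: zs_def)
  then obtain i where i: "i < length zs" "zs ! i = x"
    using assms(2) by (metis in_set_conv_nth)
  have "{z \<in> S. z < x} = set (take i zs)"
  proof (intro equalityI subsetI)
    fix z assume "z \<in> {z \<in> S. z < x}"
    then obtain j where "j < length zs" "zs ! j = z" "z < x"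
      using zs by (auto simp: in_set_conv_nth)
    moreover from this have "j < i"
      using i zs(1) by (metis linorder_neqE_nat order.asym sorted_wrt_nth_less)
    ultimately show "z \<in> set (take i zs)"
      using i by (auto simp: in_set_conv_nth)
  next
    fix z assume "z \<in> set (take i zs)"
    then obtain j where j: "j < i" "zs ! j = z"
      using i by (auto simp: in_set_conv_nth)
    then have "zs ! j < zs ! i" "zs ! j \<in> set zs"
      using i sorted_wrt_nth_less[OF zs(1)] by auto
    then show "z \<in> {z \<in> S. z < x}"
      using i j zs(2) by simp
  qed
  moreover have "distinct zs"
    by (simp add: zs_def)
  ultimately have "card {z \<in> S. z < x} = i"
    using i by (simp add: distinct_card)
  then show ?thesis
    using i by (simp add: zs_def)
qed

lemma card_less_nth:
  assumes "distinct xs"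
  shows "card {z \<in> set xs. z < x} = card {j. j < length xs \<and> xs ! j < x}"
proof -
  have "{z \<in> set xs. z < x} = (!) xs ` {j. j < length xs \<and> xs ! j < x}"
    by (auto simp: in_set_conv_nth)
  moreover have "inj_on ((!) xs) {j. j < length xs \<and> xs ! j < x}"
    using assms by (auto simp: inj_on_def nth_eq_iff_index_eq)
  ultimately show ?thesis
    by (simp add: card_image)
qed

definition same_pattern :: "nat list \<Rightarrow> nat list \<Rightarrow> bool" where
  "same_pattern xs ys \<longleftrightarrow> length ys = length xs \<and>
     (\<forall>i<length xs. \<forall>j<length xs. xs ! i < xs ! j \<longleftrightarrow> ys ! i < ys ! j)"

text \<open>A list is determined by its underlying set and the ranks of its entries there. Colouring
  each set of size \<open>Suc n\<close> by the colours of all lists formed from it makes, on a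
  homogeneous set, lists of that length with equal rank sequences agree. Shorter lists agree since
  the set lies in the one from the previous stage.\<close>

lemma Ramsey_order_pattern:
  fixes c :: "nat list \<Rightarrow> 'c"
  assumes C: "finite C" "\<And>xs. c xs \<in> C"
  shows "\<exists>Y. infinite Y \<and>
    (\<forall>xs ys. distinct xs \<longrightarrow> length xs \<le> n \<longrightarrow> set xs \<subseteq> Y \<longrightarrow> set ys \<subseteq> Y \<longrightarrow>
       same_pattern xs ys \<longrightarrow> c xs = c ys)"
proof (induction n)
  case 0
  show ?case
    by (rule exI[of _ UNIV]) (auto simp: same_pattern_def)
next
  case (Suc n)
  then obtain Z where Z: "infinite Z" and
    homogeneous: "\<And>xs ys. distinct xs \<Longrightarrow> length xs \<le> n \<Longrightarrow> set xs \<subseteq> Z \<Longrightarrow> set ys \<subseteq> Z \<Longrightarrow>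
      same_pattern xs ys \<Longrightarrow> c xs = c ys"
    by blast
  define I where "I = {is. set is \<subseteq> {..<Suc n} \<and> length is = Suc n}"
  define g where "g X = (\<lambda>is\<in>I. c (map ((!) (sorted_list_of_set X)) is))" for X
  have "finite I"
    unfolding I_def by (intro finite_lists_length_eq) auto
  then have fin: "finite (I \<rightarrow>\<^sub>E C)"
    using C by (intro finite_PiE) auto
  \<comment> \<open>\<open>Ramsey\<close> takes numbers as colours, so \<open>h\<close> numbers the
    possible colour tables \<open>g X\<close>.\<close>
  then obtain h where h: "bij_betw h (I \<rightarrow>\<^sub>E C) {0..<card (I \<rightarrow>\<^sub>E C)}"
    using ex_bij_betw_finite_nat by blast
  have g: "g X \<in> I \<rightarrow>\<^sub>E C" for X
    using C by (auto simp: g_def)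
  have "\<forall>X. X \<subseteq> Z \<and> finite X \<and> card X = Suc n \<longrightarrow> h (g X) < card (I \<rightarrow>\<^sub>E C)"
    using bij_betwE[OF h] g by auto
  from Ramsey[OF Z this] obtain Y t where Y: "Y \<subseteq> Z" "infinite Y"
    and t: "\<forall>X. X \<subseteq> Y \<and> finite X \<and> card X = Suc n \<longrightarrow> h (g X) = t"
    by (elim exE conjE)
  have "c xs = c ys"
    if xs: "distinct xs" "length xs \<le> Suc n" "set xs \<subseteq> Y" "set ys \<subseteq> Y" "same_pattern xs ys"
    for xs ys
  proof (cases "length xs = Suc n")
    case False
    then show ?thesis
      using xs Y by (intro homogeneous) auto
  next
    case len: True
    have len': "length ys = Suc n"
      and iso: "\<And>i j. i < Suc n \<Longrightarrow> j < Suc n \<Longrightarrow> xs ! i < xs ! j \<longleftrightarrow> ys ! i < ys ! j"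
      using xs len by (simp_all add: same_pattern_def)
    have ys: "distinct ys"
      unfolding distinct_conv_nth
    proof (intro allI impI)
      fix i j assume ij: "i < length ys" "j < length ys" "i \<noteq> j"
      then have "xs ! i \<noteq> xs ! j"
        using xs len len' by (simp add: nth_eq_iff_index_eq)
      then show "ys ! i \<noteq> ys ! j"
        using ij len' iso by (metis less_irrefl linorder_neqE_nat)
    qed
    \<comment> \<open>\<open>pos zs\<close> is the pattern of \<open>zs\<close> as an index list;
      reading it off the sorted underlying set returns \<open>zs\<close>
      (\<open>unrank\<close>).\<close>
    define pos where "pos zs = map (\<lambda>x. card {z \<in> set zs. z < x}) zs" for zs :: "nat list"
    have pos_eq: "pos xs = pos ys"
    proof (rule nth_equalityI)
      fix i assume "i < length (pos xs)"
      then show "pos xs ! i = pos ys ! i"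
        using xs(1) ys iso len len' by (auto simp: pos_def card_less_nth intro!: arg_cong[of _ _ card])
    qed (simp add: pos_def len len')
    have pos_in: "pos zs \<in> I" if "length zs = Suc n" "distinct zs" for zs
    proof -
      have "card {z \<in> set zs. z < x} < Suc n" if "x \<in> set zs" for x
      proof -
        have "card {z \<in> set zs. z < x} < card (set zs)"
          using that by (intro psubset_card_mono) auto
        then show ?thesis
          using \<open>length zs = Suc n\<close> \<open>distinct zs\<close> by (simp add: distinct_card)
      qed
      then show ?thesis
        using that by (auto simp: I_def pos_def)
    qed
    have unrank: "map ((!) (sorted_list_of_set (set zs))) (pos zs) = zs" for zs
      by (auto simp: pos_def sorted_list_of_set_nth_card_less intro!: map_idI)
    have "h (g (set xs)) = h (g (set ys))"
      using xs ys len len' t by (simp add: distinct_card)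
    then have "g (set xs) = g (set ys)"
      using bij_betw_imp_inj_on[OF h] g by (meson inj_onD)
    then have "g (set xs) (pos xs) = g (set ys) (pos ys)"
      by (simp add: pos_eq)
    then show ?thesis
      using pos_in[of xs] pos_in[of ys] xs(1) ys len len' by (simp add: g_def unrank)
  qed
  with Y show ?case
    by blast
qed

subsection \<open>Relative ranks\<close>

lemma inj_on_atMost_Suc: "inj_on f {..Suc t} \<Longrightarrow> inj_on f {..t}"
  by (erule inj_on_subset) simp

text \<open>With \<open>N\<close> earlier vertices better than the newcomer, its relative rank is
  \<open>N + 1\<close>. If it beats \<open>s\<close>, these vertices and \<open>s\<close> itself are
  counted in the old rank \<open>R\<close> of \<open>s\<close>, so \<open>N < R\<close>; otherwise
  everything counted in \<open>R\<close> is better than the newcomer, so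
  \<open>R \<le> N\<close>.\<close>

lemma rank_among_Suc:
  assumes "inj_on (\<rho> \<circ> \<pi>) {..Suc t}" "s \<le> t"
  shows "rank_among \<rho> \<pi> (Suc t) s =
    rank_among \<rho> \<pi> t s + of_bool (relative_rank \<rho> \<pi> (Suc t) \<le> rank_among \<rho> \<pi> t s)"
proof -
  define x where "x i = \<rho> (\<pi> i)" for i
  have inj: "inj_on x {..Suc t}"
    using assms(1) by (simp add: x_def inj_on_def)
  have neq: "x i \<noteq> x (Suc t)" if "i \<le> t" for i
    using that inj_onD[OF inj, of i "Suc t"] by auto
  define R where "R = rank_among \<rho> \<pi> t s"
  define N where "N = card {i. i \<le> t \<and> x i < x (Suc t)}"
  have R_eq: "R = card {i. i \<le> t \<and> x i \<le> x s}"
    by (simp add: R_def rank_among_def x_def)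
  have "{i. i \<le> Suc t \<and> x i \<le> x (Suc t)} = insert (Suc t) {i. i \<le> t \<and> x i < x (Suc t)}"
  proof (rule set_eqI)
    show "i \<in> {i. i \<le> Suc t \<and> x i \<le> x (Suc t)} \<longleftrightarrow>
        i \<in> insert (Suc t) {i. i \<le> t \<and> x i < x (Suc t)}" for i
      using neq[of i] by (cases "i = Suc t") auto
  qed
  then have N: "relative_rank \<rho> \<pi> (Suc t) = Suc N"
    by (simp add: relative_rank_def rank_among_def N_def flip: x_def)
  show ?thesis
  proof (cases "x (Suc t) < x s")
    case True
    have "{i. i \<le> Suc t \<and> x i \<le> x s} = insert (Suc t) {i. i \<le> t \<and> x i \<le> x s}"
      using True by (auto simp: le_Suc_eq)
    then have "rank_among \<rho> \<pi> (Suc t) s = Suc R"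
      by (simp add: rank_among_def R_eq flip: x_def)
    moreover have "N < R"
    proof -
      have "s \<in> {i. i \<le> t \<and> x i \<le> x s} - {i. i \<le> t \<and> x i < x (Suc t)}"
        using True \<open>s \<le> t\<close> by simp
      moreover have "{i. i \<le> t \<and> x i < x (Suc t)} \<subseteq> {i. i \<le> t \<and> x i \<le> x s}"
        using True by auto
      ultimately have "{i. i \<le> t \<and> x i < x (Suc t)} \<subset> {i. i \<le> t \<and> x i \<le> x s}"
        by blast
      then show ?thesis
        unfolding N_def R_eq by (intro psubset_card_mono) auto
    qed
    ultimately show ?thesis
      using N by (simp add: R_def)
  next
    case False
    then have *: "x s < x (Suc t)"
      using neq[OF \<open>s \<le> t\<close>] by simp
    then have "{i. i \<le> Suc t \<and> x i \<le> x s} = {i. i \<le> t \<and> x i \<le> x s}"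
      by (auto simp: le_Suc_eq)
    then have "rank_among \<rho> \<pi> (Suc t) s = R"
      by (simp add: rank_among_def R_eq flip: x_def)
    moreover have "R \<le> N"
      unfolding N_def R_eq using * by (intro card_mono) auto
    ultimately show ?thesis
      using N by (simp add: R_def)
  qed
qed

lemma rank_among_less_iff:
  assumes "i \<le> t" "j \<le> t"
  shows "rank_among \<rho> \<pi> t i < rank_among \<rho> \<pi> t j \<longleftrightarrow> \<rho> (\<pi> i) < \<rho> (\<pi> j)"
proof -
  have "rank_among \<rho> \<pi> t i < rank_among \<rho> \<pi> t j" if "\<rho> (\<pi> i) < \<rho> (\<pi> j)" "j \<le> t" for i j
  proof -
    have "j \<in> {k. k \<le> t \<and> \<rho> (\<pi> k) \<le> \<rho> (\<pi> j)} - {k. k \<le> t \<and> \<rho> (\<pi> k) \<le> \<rho> (\<pi> i)}"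
      using that by simp
    then have "{k. k \<le> t \<and> \<rho> (\<pi> k) \<le> \<rho> (\<pi> i)} \<subset> {k. k \<le> t \<and> \<rho> (\<pi> k) \<le> \<rho> (\<pi> j)}"
      using that by fastforce
    then show ?thesis
      unfolding rank_among_def by (intro psubset_card_mono) auto
  qed
  moreover have "rank_among \<rho> \<pi> t j \<le> rank_among \<rho> \<pi> t i" if "\<rho> (\<pi> j) \<le> \<rho> (\<pi> i)" for i j
    unfolding rank_among_def using that by (intro card_mono) auto
  ultimately show ?thesis
    using assms by (meson linorder_not_less)
qed

lemma rank_among_eq_iff:
  assumes "inj_on (\<rho> \<circ> \<pi>) {..t}" "i \<le> t" "j \<le> t"
  shows "rank_among \<rho> \<pi> t i = rank_among \<rho> \<pi> t j \<longleftrightarrow> i = j"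
proof
  assume "rank_among \<rho> \<pi> t i = rank_among \<rho> \<pi> t j"
  then have "\<rho> (\<pi> i) = \<rho> (\<pi> j)"
    using rank_among_less_iff[of i t j \<rho> \<pi>] rank_among_less_iff[of j t i \<rho> \<pi>] assms(2,3) by simp
  then show "i = j"
    using assms by (auto simp: inj_on_def)
qed simp

lemma rank_among_pos:
  assumes "s \<le> t"
  shows "0 < rank_among \<rho> \<pi> t s"
  using assms by (auto simp: rank_among_def card_gt_0_iff)

lemma relative_rank_bounds: "relative_rank \<rho> \<pi> t \<in> {1..Suc t}"
proof -
  have "relative_rank \<rho> \<pi> t \<le> card {..t}"
    unfolding relative_rank_def rank_among_def by (intro card_mono) auto
  then show ?thesis
    using rank_among_pos[of t t \<rho> \<pi>] by (simp add: relative_rank_def)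
qed

text \<open>Each relative rank tells how the earlier ranks shift (\<open>rank_among_Suc\<close>), so
  by induction the relative ranks fix the order of all arrivals so far.\<close>

lemma rank_among_cong_relative_rank:
  assumes "inj_on (\<rho> \<circ> \<pi>) {..t}" "inj_on (\<rho>' \<circ> \<pi>') {..t}"
    and "\<And>i. i \<le> t \<Longrightarrow> relative_rank \<rho> \<pi> i = relative_rank \<rho>' \<pi>' i" and "s \<le> t"
  shows "rank_among \<rho> \<pi> t s = rank_among \<rho>' \<pi>' t s"
  using assms
proof (induction t arbitrary: s)
  case 0
  then show ?case
    by (simp add: rank_among_def conj_commute cong: conj_cong)
next
  case (Suc t)
  show ?case
  proof (cases "s = Suc t")
    case True
    then show ?thesis
      using Suc.prems(3)[of s] by (simp add: relative_rank_def)
  next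
    case False
    then have s: "s \<le> t"
      using Suc.prems by simp
    have "inj_on (\<rho> \<circ> \<pi>) {..t}" "inj_on (\<rho>' \<circ> \<pi>') {..t}"
      using Suc.prems(1,2) by (blast intro: inj_on_atMost_Suc)+
    then have "rank_among \<rho> \<pi> t s = rank_among \<rho>' \<pi>' t s"
      using Suc.prems(3) s by (intro Suc.IH) (assumption | simp)+
    moreover have "relative_rank \<rho> \<pi> (Suc t) = relative_rank \<rho>' \<pi>' (Suc t)"
      using Suc.prems(3) by simp
    ultimately show ?thesis
      by (simp add: rank_among_Suc Suc.prems(1,2) s)
  qed
qed

lemma ranking_inj_on:
  assumes "ranking n \<rho>" "\<pi> permutes {..<n}" "t < n"
  shows "inj_on (\<rho> \<circ> \<pi>) {..t}"
proof (rule inj_onI)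
  fix i j assume ij: "i \<in> {..t}" "j \<in> {..t}" "(\<rho> \<circ> \<pi>) i = (\<rho> \<circ> \<pi>) j"
  then have "\<pi> i \<in> {..<n}" "\<pi> j \<in> {..<n}"
    using assms(3) permutes_in_image[OF assms(2)] by auto
  then have "\<pi> i = \<pi> j"
    using ij(3) assms(1) by (auto simp: ranking_def bij_betw_def inj_on_def)
  then show "i = j"
    using permutes_inj[OF assms(2)] by (auto simp: inj_def)
qed

lemma rank_among_final:
  assumes "ranking n \<rho>" "\<pi> permutes {..<n}" "s < n"
  shows "rank_among \<rho> \<pi> (n - 1) s = \<rho> (\<pi> s)"
proof -
  have bij: "bij_betw (\<lambda>i. \<rho> (\<pi> i)) {..<n} {1..n}"
    using bij_betw_trans[OF permutes_imp_bij[OF assms(2)], of \<rho> "{1..n}"] assms(1)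
    by (simp add: ranking_def comp_def)
  have inj: "inj_on (\<lambda>i. \<rho> (\<pi> i)) {..<n}" and img: "(\<lambda>i. \<rho> (\<pi> i)) ` {..<n} = {1..n}"
    using bij by (auto simp: bij_betw_def)
  have le: "\<rho> (\<pi> s) \<le> n"
    using img \<open>s < n\<close> by (metis atLeastAtMost_iff imageI lessThan_iff)
  have "(\<lambda>i. \<rho> (\<pi> i)) ` {i. i \<le> n - 1 \<and> \<rho> (\<pi> i) \<le> \<rho> (\<pi> s)} = {1..\<rho> (\<pi> s)}"
  proof (intro equalityI subsetI)
    fix y assume y: "y \<in> {1..\<rho> (\<pi> s)}"
    then have "y \<in> (\<lambda>i. \<rho> (\<pi> i)) ` {..<n}"
      using img le by auto
    then show "y \<in> (\<lambda>i. \<rho> (\<pi> i)) ` {i. i \<le> n - 1 \<and> \<rho> (\<pi> i) \<le> \<rho> (\<pi> s)}"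
      using y by force
  next
    fix y assume "y \<in> (\<lambda>i. \<rho> (\<pi> i)) ` {i. i \<le> n - 1 \<and> \<rho> (\<pi> i) \<le> \<rho> (\<pi> s)}"
    then obtain i where i: "i \<le> n - 1" "y = \<rho> (\<pi> i)" "y \<le> \<rho> (\<pi> s)"
      by blast
    then have "y \<in> {1..n}"
      using img \<open>s < n\<close> by auto
    with i show "y \<in> {1..\<rho> (\<pi> s)}"
      by simp
  qed
  moreover have "inj_on (\<lambda>i. \<rho> (\<pi> i)) {i. i \<le> n - 1 \<and> \<rho> (\<pi> i) \<le> \<rho> (\<pi> s)}"
    using inj \<open>s < n\<close> by (auto intro: inj_on_subset)
  ultimately have "card {i. i \<le> n - 1 \<and> \<rho> (\<pi> i) \<le> \<rho> (\<pi> s)} = card {1..\<rho> (\<pi> s)}"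
    by (metis card_image)
  then show ?thesis
    by (simp add: rank_among_def)
qed

text \<open>This is the independence of the relative ranks: a uniform arrival order becomes a
  uniform point of a product. Since the relative ranks determine the permutation and both sides have
  \<open>n!\<close> elements, injectivity suffices.\<close>

lemma bij_betw_relative_ranks:
  assumes \<rho>: "ranking n \<rho>"
  shows "bij_betw (\<lambda>\<pi>. restrict (relative_rank \<rho> \<pi>) {..<n}) {\<pi>. \<pi> permutes {..<n}}
           (\<Pi>\<^sub>E i\<in>{..<n}. {1..Suc i})" (is "bij_betw ?f ?P ?R")
proof -
  have inj: "inj_on ?f ?P"
  proof (rule inj_onI)
    fix \<pi> \<pi>' assume \<pi>: "\<pi> \<in> ?P" "\<pi>' \<in> ?P" and eq: "?f \<pi> = ?f \<pi>'"
    have "\<pi> s = \<pi>' s" for s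
    proof (cases "s < n")
      case True
      have "relative_rank \<rho> \<pi> i = relative_rank \<rho> \<pi>' i" if "i \<le> n - 1" for i
        using fun_cong[OF eq, of i] that True by (auto simp: restrict_def split: if_splits)
      then have "rank_among \<rho> \<pi> (n - 1) s = rank_among \<rho> \<pi>' (n - 1) s"
        using \<pi> True by (intro rank_among_cong_relative_rank ranking_inj_on[OF \<rho>]) auto
      then have "\<rho> (\<pi> s) = \<rho> (\<pi>' s)"
        using \<pi> True rank_among_final[OF \<rho>] by simp
      moreover have "\<pi> s \<in> {..<n}" "\<pi>' s \<in> {..<n}"
        using \<pi> True permutes_in_image[of \<pi>] permutes_in_image[of \<pi>'] by blast+
      ultimately show ?thesis
        using \<rho> by (auto simp: ranking_def bij_betw_def inj_on_def)
    next
      case False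
      then show ?thesis
        using \<pi> permutes_not_in[of \<pi>] permutes_not_in[of \<pi>'] by auto
    qed
    then show "\<pi> = \<pi>'"
      by blast
  qed
  have "?f ` ?P \<subseteq> ?R"
    using relative_rank_bounds by (intro image_subsetI restrict_PiE_iff[THEN iffD2]) blast
  moreover have "card (?f ` ?P) = card ?R"
    by (simp add: card_image[OF inj] card_permutations[of "{..<n}"] card_PiE fact_prod_Suc
        atLeast0LessThan)
  moreover have "finite ?R"
    by (intro finite_PiE) auto
  ultimately show ?thesis
    using inj by (simp add: bij_betw_def card_subset_eq)
qed

subsection \<open>The leader and the top pair\<close>

text \<open>\<open>leader r t\<close> refers to the arrivals before time \<open>t\<close>; its value
  at \<open>t = 0\<close> is a placeholder.\<close>

primrec leader :: "(nat \<Rightarrow> nat) \<Rightarrow> nat \<Rightarrow> nat" where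
  "leader r 0 = 0"
| "leader r (Suc t) = (if r t = 1 then t else leader r t)"

text \<open>Tracks whether the top pair of the first \<open>t\<close> arrivals is matched within
  itself. Only a newcomer of rank at most 2 changes this pair, and then only its own decision
  counts. At the first arrival the equation asks for time 0 as its own partner, which no legal
  decision names.\<close>

primrec joined :: "(nat \<Rightarrow> nat) \<Rightarrow> nat option list \<Rightarrow> nat \<Rightarrow> bool" where
  "joined r ds 0 = False"
| "joined r ds (Suc t) = (if r t \<le> 2 then ds ! t = Some (leader r t) else joined r ds t)"

lemma leader_less: "0 < t \<Longrightarrow> leader r t < t"
proof (induction t)
  case (Suc t)
  then show ?case
    by (cases t) (auto simp: less_Suc_eq)
qed simp

lemma leader_cong: "(\<And>i. i < t \<Longrightarrow> r i = r' i) \<Longrightarrow> leader r t = leader r' t"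
  by (induction t) auto

lemma joined_cong: "(\<And>i. i < t \<Longrightarrow> r i = r' i) \<Longrightarrow> joined r ds t = joined r' ds t"
  by (induction t) (auto cong: leader_cong)

lemma joined_append: "t \<le> length ds \<Longrightarrow> joined r (ds @ ds') t = joined r ds t"
  by (induction t) (auto simp: nth_append)

lemma rank_among_eq_1_iff:
  assumes "inj_on (\<rho> \<circ> \<pi>) {..t}" "s \<le> t"
  shows "rank_among \<rho> \<pi> t s = 1 \<longleftrightarrow> s = leader (relative_rank \<rho> \<pi>) (Suc t)"
proof -
  have "rank_among \<rho> \<pi> t (leader (relative_rank \<rho> \<pi>) (Suc t)) = 1"
    using assms(1)
  proof (induction t)
    case 0
    have "{i. i = 0 \<and> \<rho> (\<pi> i) \<le> \<rho> (\<pi> 0)} = {0}"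
      by auto
    then show ?case
      by (simp add: relative_rank_def rank_among_def)
  next
    case (Suc t)
    let ?l = "leader (relative_rank \<rho> \<pi>) (Suc t)"
    have "rank_among \<rho> \<pi> t ?l = 1"
      by (intro Suc.IH inj_on_atMost_Suc[OF Suc.prems])
    moreover have "?l \<le> t"
      using leader_less[of "Suc t"] by (simp add: less_Suc_eq_le del: leader.simps)
    moreover have "0 < relative_rank \<rho> \<pi> (Suc t)"
      using relative_rank_bounds[of \<rho> \<pi> "Suc t"] by simp
    ultimately have "relative_rank \<rho> \<pi> (Suc t) \<noteq> 1 \<Longrightarrow> rank_among \<rho> \<pi> (Suc t) ?l = 1"
      by (simp add: rank_among_Suc[OF Suc.prems] del: leader.simps)
    then show ?case
      by (subst leader.simps) (simp add: relative_rank_def del: leader.simps)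
  qed
  moreover have "leader (relative_rank \<rho> \<pi>) (Suc t) \<le> t"
    using leader_less[of "Suc t"] by (simp add: less_Suc_eq_le del: leader.simps)
  ultimately show ?thesis
    using rank_among_eq_iff[OF assms(1), of s "leader (relative_rank \<rho> \<pi>) (Suc t)"] assms(2)
    by (simp del: leader.simps)
qed

text \<open>A newcomer of rank at most 2 pushes every old rank of at least 2 beyond 2, so of the old
  vertices only the leader stays in the pair.\<close>

lemma top_two_Suc:
  assumes inj: "inj_on (\<rho> \<circ> \<pi>) {..Suc t}"
  shows "top_two \<rho> \<pi> (Suc t) =
    (if relative_rank \<rho> \<pi> (Suc t) \<le> 2 then {leader (relative_rank \<rho> \<pi>) (Suc t), Suc t}
     else top_two \<rho> \<pi> t)"
proof -
  let ?r = "relative_rank \<rho> \<pi> (Suc t)"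
  let ?l = "leader (relative_rank \<rho> \<pi>) (Suc t)"
  have inj': "inj_on (\<rho> \<circ> \<pi>) {..t}"
    using inj by (rule inj_on_atMost_Suc)
  have l: "?l \<le> t"
    using leader_less[of "Suc t"] by (simp add: less_Suc_eq_le del: leader.simps)
  have r: "1 \<le> ?r"
    using relative_rank_bounds[of \<rho> \<pi> "Suc t"] by simp
  have "s \<in> top_two \<rho> \<pi> (Suc t) \<longleftrightarrow>
      s \<in> (if ?r \<le> 2 then {?l, Suc t} else top_two \<rho> \<pi> t)" for s
  proof (cases "s \<le> t")
    case True
    have "0 < rank_among \<rho> \<pi> t s"
      using True by (rule rank_among_pos)
    then show ?thesis
      using r True rank_among_eq_1_iff[OF inj' True]
      by (auto simp: top_two_def rank_among_Suc[OF inj True] simp del: leader.simps)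
  next
    case False
    then have "s = Suc t \<or> Suc t < s"
      by linarith
    then show ?thesis
    proof
      assume "Suc t < s"
      then show ?thesis
        using l by (auto simp: top_two_def simp del: leader.simps)
    qed (use l in \<open>auto simp: top_two_def relative_rank_def simp del: leader.simps\<close>)
  qed
  then show ?thesis
    by blast
qed

lemma top_two_eq_pair_iff:
  assumes "inj_on (\<rho> \<circ> \<pi>) {..t}" "s < t"
  shows "top_two \<rho> \<pi> t = {s, t} \<longleftrightarrow>
    relative_rank \<rho> \<pi> t \<le> 2 \<and> s = leader (relative_rank \<rho> \<pi>) t"
proof -
  obtain u where u: "t = Suc u"
    using assms(2) by (cases t) auto
  have "top_two \<rho> \<pi> u \<subseteq> {..u}"
    by (auto simp: top_two_def)
  then have "top_two \<rho> \<pi> u \<noteq> {s, t}"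
    using u by auto
  moreover have "{l, t} = {s, t} \<longleftrightarrow> s = l" for l
    using assms(2) by (auto simp: doubleton_eq_iff)
  ultimately show ?thesis
    using top_two_Suc[of \<rho> \<pi> u] assms(1) unfolding u by (auto simp del: leader.simps)
qed

text \<open>An invariant of all runs of online algorithms. It orients each matched pair by arrival
  time, so that an unordered pair can be read back as a decision, and excludes loops.\<close>

definition past_partners :: "nat option list \<Rightarrow> bool" where
  "past_partners ds \<longleftrightarrow> (\<forall>t<length ds. \<forall>s. ds ! t = Some s \<longrightarrow> s < t)"

lemma past_partners_snoc:
  "past_partners (ds @ [d]) \<longleftrightarrow> past_partners ds \<and> (\<forall>s. d = Some s \<longrightarrow> s < length ds)"
  by (auto simp: past_partners_def All_less_Suc nth_append)

text \<open>As partners are earlier, a pair containing the newcomer can only be matched by its own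
  decision, and a pair of older vertices only by an older decision.\<close>

lemma joined_iff_top_two:
  assumes "inj_on (\<rho> \<circ> \<pi>) {..t}" "past_partners ds" "t < length ds"
  shows "joined (relative_rank \<rho> \<pi>) ds (Suc t) \<longleftrightarrow>
    (\<exists>s u. u \<le> t \<and> ds ! u = Some s \<and> top_two \<rho> \<pi> t = {s, u})"
  using assms(1,3)
proof (induction t)
  case 0
  have "ds ! 0 \<noteq> Some s" for s
    using assms(2) 0 by (auto simp: past_partners_def)
  then show ?case
    using relative_rank_bounds[of \<rho> \<pi> 0] by auto
next
  case (Suc t)
  let ?r = "relative_rank \<rho> \<pi>"
  have past: "s < u" if "u \<le> Suc t" "ds ! u = Some s" for s u
    using assms(2) Suc.prems(2) that by (auto simp: past_partners_def)
  show ?case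
  proof (cases "?r (Suc t) \<le> 2")
    case True
    have l: "leader ?r (Suc t) < Suc t"
      by (rule leader_less) simp
    have "{leader ?r (Suc t), Suc t} = {s, u} \<longleftrightarrow> s = leader ?r (Suc t) \<and> u = Suc t"
      if "s < u" for s u
      using that l by (auto simp: doubleton_eq_iff simp del: leader.simps)
    then have "(\<exists>s u. u \<le> Suc t \<and> ds ! u = Some s \<and> {leader ?r (Suc t), Suc t} = {s, u}) \<longleftrightarrow>
        ds ! Suc t = Some (leader ?r (Suc t))"
      using past by (auto simp del: leader.simps)
    then show ?thesis
      using True by (simp add: top_two_Suc[OF Suc.prems(1)] del: leader.simps)
  next
    case False
    have "joined ?r ds (Suc t) \<longleftrightarrow> (\<exists>s u. u \<le> t \<and> ds ! u = Some s \<and> top_two \<rho> \<pi> t = {s, u})"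
      using Suc.prems(2) by (intro Suc.IH inj_on_atMost_Suc[OF Suc.prems(1)]) simp
    moreover have "top_two \<rho> \<pi> t \<subseteq> {..t}"
      by (auto simp: top_two_def)
    ultimately show ?thesis
      using False by (auto simp: top_two_Suc[OF Suc.prems(1)] le_Suc_eq
          simp del: leader.simps)
  qed
qed

text \<open>After the last arrival relative ranks are true ranks, so the two best vertices are the
  image under \<open>\<pi>\<close> of \<open>top_two\<close> at time \<open>n - 1\<close>.\<close>

lemma top_edge_matched_iff:
  assumes \<rho>: "ranking n \<rho>" and \<pi>: "\<pi> permutes {..<n}" and "0 < n"
    and ds: "length ds = n" "past_partners ds"
  shows "{v. v < n \<and> \<rho> v \<le> 2} \<in> matched_edges \<pi> ds \<longleftrightarrow> joined (relative_rank \<rho> \<pi>) ds n"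
proof -
  have "{v. v < n \<and> \<rho> v \<le> 2} = \<pi> ` top_two \<rho> \<pi> (n - 1)"
  proof (intro equalityI subsetI)
    fix v assume v: "v \<in> {v. v < n \<and> \<rho> v \<le> 2}"
    then obtain s where "s < n" "v = \<pi> s"
      using permutes_image[OF \<pi>] by (metis (no_types, lifting) imageE lessThan_iff mem_Collect_eq)
    with v show "v \<in> \<pi> ` top_two \<rho> \<pi> (n - 1)"
      using rank_among_final[OF \<rho> \<pi>, of s] by (auto simp: top_two_def)
  next
    fix v assume "v \<in> \<pi> ` top_two \<rho> \<pi> (n - 1)"
    then obtain s where s: "s \<le> n - 1" "rank_among \<rho> \<pi> (n - 1) s \<le> 2" "v = \<pi> s"
      by (auto simp: top_two_def)
    then have "s < n"
      using \<open>0 < n\<close> by simp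
    with s show "v \<in> {v. v < n \<and> \<rho> v \<le> 2}"
      using permutes_in_image[OF \<pi>, of s] rank_among_final[OF \<rho> \<pi>, of s] by simp
  qed
  moreover have "\<pi> ` X = {\<pi> s, \<pi> u} \<longleftrightarrow> X = {s, u}" for X s u
    using inj_image_eq_iff[OF permutes_inj[OF \<pi>], of X "{s, u}"] by simp
  ultimately have "{v. v < n \<and> \<rho> v \<le> 2} \<in> matched_edges \<pi> ds \<longleftrightarrow>
      (\<exists>s u. u \<le> n - 1 \<and> ds ! u = Some s \<and> top_two \<rho> \<pi> (n - 1) = {s, u})"
    using ds \<open>0 < n\<close> by (auto simp: matched_edges_def le_diff_conv2 less_eq_Suc_le)
  also have "\<dots> \<longleftrightarrow> joined (relative_rank \<rho> \<pi>) ds (Suc (n - 1))"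
    using ds \<open>0 < n\<close>
    by (intro joined_iff_top_two[symmetric] ranking_inj_on[OF \<rho> \<pi>]) auto
  finally show ?thesis
    using \<open>0 < n\<close> by simp
qed

subsection \<open>Expected gain of a run\<close>

lemma finite_unmatched: "finite (unmatched ds)"
  by (simp add: unmatched_def)

lemma online_algorithmD:
  assumes "online_algorithm n A" "length ds < n" "length os = Suc (length ds)"
  shows "set_pmf (A os ds) \<subseteq> insert None (Some ` unmatched ds)"
  using assms by (simp add: online_algorithm_def)

lemma set_pmf_run:
  assumes "online_algorithm n A" "t \<le> n"
  shows "finite (set_pmf (run A obs t))"
    and "ds \<in> set_pmf (run A obs t) \<Longrightarrow> length ds = t \<and> past_partners ds"
proof -
  have "finite (set_pmf (run A obs t)) \<and>
      (\<forall>ds\<in>set_pmf (run A obs t). length ds = t \<and> past_partners ds)"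
    using assms(2)
  proof (induction t)
    case 0
    then show ?case
      by (simp add: past_partners_def)
  next
    case (Suc t)
    have A: "set_pmf (A (map obs [0..<Suc t]) ds) \<subseteq> insert None (Some ` unmatched ds)"
      if "ds \<in> set_pmf (run A obs t)" for ds
      using Suc that by (intro online_algorithmD[OF assms(1)]) auto
    then have "finite (set_pmf (A (map obs [0..<Suc t]) ds))"
      if "ds \<in> set_pmf (run A obs t)" for ds
      using that finite_unmatched by (meson finite_imageI finite_insert finite_subset)
    moreover have "d = Some s \<Longrightarrow> s < t"
      if "ds \<in> set_pmf (run A obs t)" "d \<in> set_pmf (A (map obs [0..<Suc t]) ds)" for ds d s
      using A[OF that(1)] that Suc by (auto simp: unmatched_def)
    ultimately show ?case
      using Suc by (auto simp: past_partners_snoc simp del: upt_Suc)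
  qed
  then show "finite (set_pmf (run A obs t))"
    and "ds \<in> set_pmf (run A obs t) \<Longrightarrow> length ds = t \<and> past_partners ds"
    by blast+
qed

text \<open>The expected value of \<open>F\<close> at the end, given the history \<open>ds\<close>
  and \<open>k\<close> decisions to come. \<open>run\<close> peels off the last decision,
  \<open>gain\<close> the next one, as backward induction needs.\<close>

primrec gain :: "'o policy \<Rightarrow> (nat \<Rightarrow> 'o) \<Rightarrow> (nat option list \<Rightarrow> real) \<Rightarrow> nat \<Rightarrow> nat option list \<Rightarrow> real"
where
  "gain A obs F 0 ds = F ds"
| "gain A obs F (Suc k) ds =
     measure_pmf.expectation (A (map obs [0..<Suc (length ds)]) ds) (\<lambda>d. gain A obs F k (ds @ [d]))"

lemma expectation_run_Suc:
  fixes F :: "nat option list \<Rightarrow> real"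
  assumes "online_algorithm n A" "t < n"
  shows "measure_pmf.expectation (run A obs (Suc t)) F =
    measure_pmf.expectation (run A obs t) (gain A obs F 1)"
proof -
  let ?R = "set_pmf (run A obs t)"
  have fin: "finite ?R"
    using set_pmf_run(1)[OF assms(1)] assms(2) by simp
  have "finite (set_pmf (A (map obs [0..<Suc t]) ds))" if "ds \<in> ?R" for ds
  proof -
    have "set_pmf (A (map obs [0..<Suc t]) ds) \<subseteq> insert None (Some ` unmatched ds)"
      using set_pmf_run(2)[OF assms(1) _ that] assms(2) by (intro online_algorithmD[OF assms(1)]) auto
    then show ?thesis
      using finite_unmatched by (meson finite_imageI finite_insert finite_subset)
  qed
  then have "measure_pmf.expectation (run A obs (Suc t)) F =
      (\<Sum>ds\<in>?R. pmf (run A obs t) ds *\<^sub>R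
         measure_pmf.expectation (A (map obs [0..<Suc t]) ds \<bind> (\<lambda>d. return_pmf (ds @ [d]))) F)"
    unfolding run.simps using fin by (intro pmf_expectation_bind) (auto simp del: upt_Suc)
  also have "\<dots> = (\<Sum>ds\<in>?R. pmf (run A obs t) ds *\<^sub>R gain A obs F 1 ds)"
    using set_pmf_run(2)[OF assms(1), of t] assms(2)
    by (intro sum.cong refl) (simp add: map_pmf_def[symmetric] del: upt_Suc)
  also have "\<dots> = measure_pmf.expectation (run A obs t) (gain A obs F 1)"
    using fin by (intro integral_measure_pmf[symmetric]) auto
  finally show ?thesis .
qed

lemma expectation_run_eq_gain:
  assumes "online_algorithm n A" "t + k = n"
  shows "measure_pmf.expectation (run A obs n) F =
    measure_pmf.expectation (run A obs t) (gain A obs F k)"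
  using assms(2)
proof (induction k arbitrary: t)
  case (Suc k)
  have "measure_pmf.expectation (run A obs n) F =
      measure_pmf.expectation (run A obs (Suc t)) (gain A obs F k)"
    using Suc.prems by (intro Suc.IH) simp
  also have "\<dots> = measure_pmf.expectation (run A obs t) (gain A obs (gain A obs F k) 1)"
    using Suc.prems by (intro expectation_run_Suc[OF assms(1)]) simp
  also have "gain A obs (gain A obs F k) 1 = gain A obs F (Suc k)"
    by (simp add: fun_eq_iff)
  finally show ?case .
next
  case 0
  have "gain A obs F 0 = F"
    by (simp add: fun_eq_iff)
  with 0 show ?case
    by simp
qed

lemma expectation_random_matching:
  fixes f :: "nat set set \<Rightarrow> real"
  assumes "online_algorithm n A"
  shows "measure_pmf.expectation (random_matching n A obs) f =
    (\<Sum>\<pi> | \<pi> permutes {..<n}.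
       measure_pmf.expectation (run A (obs \<pi>) n) (\<lambda>ds. f (matched_edges \<pi> ds))) / fact n"
proof -
  let ?P = "{\<pi>. \<pi> permutes {..<n}}"
  have "finite (set_pmf (run A (obs \<pi>) n \<bind> (\<lambda>ds. return_pmf (matched_edges \<pi> ds))))" for \<pi>
    using set_pmf_run(1)[OF assms order_refl] by simp
  then have "measure_pmf.expectation (random_matching n A obs) f =
     (\<Sum>\<pi>\<in>?P. measure_pmf.expectation
        (run A (obs \<pi>) n \<bind> (\<lambda>ds. return_pmf (matched_edges \<pi> ds))) f /\<^sub>R real (card ?P))"
    unfolding random_matching_def
    by (intro pmf_expectation_bind_pmf_of_set) (auto simp: finite_permutations intro: permutes_id)
  also have "\<dots> = (\<Sum>\<pi>\<in>?P. measure_pmf.expectation (run A (obs \<pi>) n)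
        (\<lambda>ds. f (matched_edges \<pi> ds))) / fact n"
    by (simp add: map_pmf_def[symmetric] card_permutations[of "{..<n}"] divide_inverse
        sum_distrib_left mult.commute)
  finally show ?thesis .
qed

lemma gain_bounds:
  assumes "online_algorithm n A" "length ds + k = n" "\<And>ds. F ds \<in> {0..1}"
  shows "gain A obs F k ds \<in> {0..1}"
  using assms(2)
proof (induction k arbitrary: ds)
  case 0
  then show ?case
    using assms(3) by simp
next
  case (Suc k)
  let ?p = "A (map obs [0..<Suc (length ds)]) ds"
  have "gain A obs F k (ds @ [d]) \<in> {0..1}" for d
    using Suc.prems by (intro Suc.IH) simp
  then have "measure_pmf.expectation ?p (\<lambda>d. gain A obs F k (ds @ [d])) \<in> {0..1}"
    by (auto intro!: Bochner_Integration.integral_nonneg measure_pmf.integral_le_const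
        measure_pmf.integrable_const_bound[where B = 1])
  then show ?case
    by simp
qed

subsection \<open>Averaging over relative ranks\<close>

text \<open>The mean of \<open>F\<close> when the ranks at times \<open>t, ..., t + k - 1\<close>
  are independent and uniform and the other entries of \<open>r\<close> are kept. The earliest rank
  is averaged outermost, to match \<open>gain\<close>.\<close>

primrec rank_average :: "nat \<Rightarrow> nat \<Rightarrow> ((nat \<Rightarrow> nat) \<Rightarrow> real) \<Rightarrow> (nat \<Rightarrow> nat) \<Rightarrow> real" where
  "rank_average 0 t F r = F r"
| "rank_average (Suc k) t F r =
     (\<Sum>j=1..Suc t. rank_average k (Suc t) F (r(t := j))) / real (Suc t)"

lemma rank_average_mono:
  assumes "\<And>r'. (\<And>i. i < t \<Longrightarrow> r' i = r i) \<Longrightarrow>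
    (\<And>i. t \<le> i \<Longrightarrow> i < t + k \<Longrightarrow> r' i \<in> {1..Suc i}) \<Longrightarrow> F r' \<le> G r'"
  shows "rank_average k t F r \<le> rank_average k t G r"
  using assms
proof (induction k arbitrary: t r)
  case (Suc k)
  have "rank_average k (Suc t) F (r(t := j)) \<le> rank_average k (Suc t) G (r(t := j))"
    if j: "j \<in> {1..Suc t}" for j
  proof (rule Suc.IH)
    fix r' assume r': "\<And>i. i < Suc t \<Longrightarrow> r' i = (r(t := j)) i"
      "\<And>i. Suc t \<le> i \<Longrightarrow> i < Suc t + k \<Longrightarrow> r' i \<in> {1..Suc i}"
    show "F r' \<le> G r'"
    proof (rule Suc.prems)
      show "r' i = r i" if "i < t" for i
        using r'(1)[of i] that by simp
      show "r' i \<in> {1..Suc i}" if "t \<le> i" "i < t + Suc k" for i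
        using r'(1)[of i] r'(2)[of i] that j by (cases "i = t") auto
    qed
  qed
  then show ?case
    by (auto intro!: divide_right_mono sum_mono simp del: sum.cl_ivl_Suc)
qed simp

lemma rank_average_cong:
  assumes "\<And>r'. (\<And>i. i < t \<Longrightarrow> r' i = r i) \<Longrightarrow>
    (\<And>i. t \<le> i \<Longrightarrow> i < t + k \<Longrightarrow> r' i \<in> {1..Suc i}) \<Longrightarrow> F r' = G r'"
  shows "rank_average k t F r = rank_average k t G r"
  using assms by (intro antisym rank_average_mono) simp_all

lemma rank_average_add_const:
  "rank_average k t (\<lambda>r. F r + c) r = rank_average k t F r + c"
proof (induction k arbitrary: t r)
  case (Suc k)
  have "(\<Sum>j=1..Suc t. rank_average k (Suc t) F (r(t := j)) + c) / real (Suc t) =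
      (\<Sum>j=1..Suc t. rank_average k (Suc t) F (r(t := j))) / real (Suc t) + c"
    by (simp only: sum.distrib sum_constant card_atLeastAtMost add_divide_distrib) simp
  then show ?case
    by (simp only: rank_average.simps Suc.IH)
qed simp

lemma rank_average_sum:
  "rank_average k t (\<lambda>r. \<Sum>d\<in>D. c d * F d r) r = (\<Sum>d\<in>D. c d * rank_average k t (F d) r)"
proof (induction k arbitrary: t r)
  case (Suc k)
  show ?case
    unfolding rank_average.simps Suc.IH
    by (subst sum.swap) (simp add: sum_distrib_left sum_divide_distrib del: sum.cl_ivl_Suc)
qed simp

text \<open>The definition splits off the earliest rank; splitting off the latest fits the
  decomposition of the product space in \<open>rank_average_eq_sum\<close>.\<close>

lemma rank_average_Suc_last:
  "rank_average (Suc k) t F r =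
    rank_average k t (\<lambda>r. (\<Sum>j=1..Suc (t + k). F (r(t + k := j))) / real (Suc (t + k))) r"
proof (induction k arbitrary: t r)
  case (Suc k)
  show ?case
    by (subst rank_average.simps(2), subst Suc.IH) (simp del: sum.cl_ivl_Suc)
qed simp

text \<open>Extensional functions on \<open>{..<n}\<close> are \<open>undefined\<close> elsewhere;
  with this base vector the averaged vectors are exactly the points of the product space.\<close>

lemma rank_average_eq_sum:
  "rank_average n 0 F (\<lambda>_. undefined) = (\<Sum>r\<in>(\<Pi>\<^sub>E i\<in>{..<n}. {1..Suc i}). F r) / fact n"
proof (induction n arbitrary: F)
  case (Suc n)
  let ?R = "\<Pi>\<^sub>E i\<in>{..<n}. {1..Suc i}"
  have "(\<Sum>r\<in>(\<Pi>\<^sub>E i\<in>{..<Suc n}. {1..Suc i}). F r) =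
      (\<Sum>(j, r)\<in>{1..Suc n} \<times> ?R. F (r(n := j)))"
    unfolding lessThan_Suc PiE_insert_eq
    by (subst sum.reindex[OF inj_combinator]) (simp_all add: case_prod_beta')
  also have "\<dots> = (\<Sum>r\<in>?R. \<Sum>j=1..Suc n. F (r(n := j)))"
    by (subst sum.cartesian_product[symmetric], subst sum.swap) simp
  finally show ?case
    by (simp only: rank_average_Suc_last Suc.IH)
      (simp add: sum_divide_distrib[symmetric] del: sum.cl_ivl_Suc)
qed simp

subsection \<open>The optimal ordinal policy\<close>

datatype phase = Leader_Free | Pair_Joined | Leader_Taken

definition phase_at :: "(nat \<Rightarrow> nat) \<Rightarrow> nat option list \<Rightarrow> nat \<Rightarrow> phase" where
  "phase_at r ds t =
     (if leader r t \<in> unmatched ds then Leader_Free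
      else if joined r ds t then Pair_Joined else Leader_Taken)"

text \<open>One Bellman step: \<open>v\<close> values the phase after the arrival of a newcomer of
  relative rank \<open>j\<close>. The only choice is whether to join a free leader with a newcomer
  of rank at most 2. A newcomer of rank 2 displaces the partner in a joined pair, whose leader then
  counts as matched outside the pair.\<close>

fun best :: "(phase \<Rightarrow> real) \<Rightarrow> nat \<Rightarrow> phase \<Rightarrow> real" where
  "best v j Leader_Free = (if j \<le> 2 then max (v Pair_Joined) (v Leader_Free) else v Leader_Free)"
| "best v j Leader_Taken = (if j = 1 then v Leader_Free else v Leader_Taken)"
| "best v j Pair_Joined =
     (if j = 1 then v Leader_Free else if j = 2 then v Leader_Taken else v Pair_Joined)"

text \<open>
  The optimal success probability from phase \<open>s\<close> on when \<open>k\<close> of the \<open>n\<close> arrivals remain. The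
  phase before the first arrival is \<open>Leader_Taken\<close>: there is no vertex to match the newcomer to.
\<close>

primrec opt :: "nat \<Rightarrow> nat \<Rightarrow> phase \<Rightarrow> real" where
  "opt n 0 s = of_bool (s = Pair_Joined)"
| "opt n (Suc k) s = (\<Sum>j=1..n - k. best (opt n k) j s) / real (n - k)"

lemma best_nonneg: "(\<And>s. 0 \<le> v s) \<Longrightarrow> 0 \<le> best v j s"
  by (cases s) (auto simp: le_max_iff_disj)

lemma opt_nonneg: "0 \<le> opt n k s"
  by (induction k arbitrary: s) (auto intro!: divide_nonneg_nonneg sum_nonneg best_nonneg)

text \<open>With no arrivals left both values are 0, and \<open>best\<close> preserves the
  inequality for every rank. Hence spending the leader outside the top pair never beats keeping it
  free.\<close>

lemma opt_Leader_Taken_le: "opt n k Leader_Taken \<le> opt n k Leader_Free"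
proof (induction k)
  case (Suc k)
  then have "best (opt n k) j Leader_Taken \<le> best (opt n k) j Leader_Free" for j
    by (auto simp: le_max_iff_disj)
  then show ?case
    by (auto intro!: divide_right_mono sum_mono)
qed simp

section \<open>Transitions between phases\<close>

lemma unmatched_snoc_iff:
  "s < length ds \<Longrightarrow> s \<in> unmatched (ds @ [d]) \<longleftrightarrow> s \<in> unmatched ds \<and> d \<noteq> Some s"
  by (auto simp: unmatched_def nth_append)

lemma unmatched_snoc_length:
  assumes "past_partners ds"
  shows "length ds \<in> unmatched (ds @ [d]) \<longleftrightarrow> d = None"
proof -
  have "Some (length ds) \<notin> set ds"
    using assms by (force simp: past_partners_def in_set_conv_nth)
  then show ?thesis
    by (auto simp: unmatched_def)
qed

text \<open>The leader belongs to the top pair, so it is an endpoint of the decision that joined it;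
  thus \<open>Leader_Free\<close> and a joined pair exclude each other.\<close>

lemma joined_imp_leader_matched:
  "joined r ds t \<Longrightarrow> t \<le> length ds \<Longrightarrow> leader r t \<notin> unmatched ds"
proof (induction t)
  case (Suc t)
  then show ?case
    by (auto simp: unmatched_def split: if_splits) (metis Suc_le_eq nth_mem)
qed simp

lemma phase_at_cong: "(\<And>i. i < t \<Longrightarrow> r i = r' i) \<Longrightarrow> phase_at r ds t = phase_at r' ds t"
  using leader_cong[of t r r'] joined_cong[of t r r' ds] by (simp add: phase_at_def)

text \<open>A decision not considered by \<open>best\<close> can only give
  \<open>Leader_Taken\<close> in place of \<open>Leader_Free\<close>, by matching a free leader or a
  new one to a vertex outside the top pair; by the hypothesis on \<open>v\<close> this is no
  better.\<close>

lemma phase_at_step_le_best: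
  assumes v: "v Leader_Taken \<le> v Leader_Free" and t: "length ds = t"
    and d: "d \<in> insert None (Some ` unmatched ds)" and r: "r t \<in> {1..Suc t}"
  shows "v (phase_at r (ds @ [d]) (Suc t)) \<le> best v (r t) (phase_at r ds t)"
proof (cases "t = 0")
  case True
  then show ?thesis
    using t d r by (auto simp: phase_at_def unmatched_def)
next
  case False
  let ?l = "leader r t"
  have l: "?l < length ds"
    using False t by (simp add: leader_less)
  have J: "joined r (ds @ [d]) (Suc t) = (if r t \<le> 2 then d = Some ?l else joined r ds t)"
    using t by (simp add: nth_append joined_append)
  show ?thesis
  proof (cases "?l \<in> unmatched ds")
    case True
    then have "\<not> joined r ds t"
      using joined_imp_leader_matched[of r ds t] t by auto
    then show ?thesis
      using True v J by (auto simp: phase_at_def le_max_iff_disj simp del: joined.simps)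
  next
    case False
    then have d': "d \<noteq> Some ?l"
      using d by auto
    have "?l \<notin> unmatched (ds @ [d])"
      using False l by (simp add: unmatched_snoc_iff)
    then show ?thesis
      using False v J d' r by (auto simp: phase_at_def le_max_iff_disj simp del: joined.simps)
  qed
qed

definition ordinal_policy :: "(nat \<Rightarrow> bool) \<Rightarrow> nat policy" where
  "ordinal_policy \<theta> os ds =
     (let t = length ds; l = leader ((!) os) t
      in return_pmf (if os ! t \<le> 2 \<and> l \<in> unmatched ds \<and> \<theta> t then Some l else None))"

lemma online_ordinal_policy: "online_algorithm n (ordinal_policy \<theta>)"
  by (auto simp: online_algorithm_def ordinal_policy_def Let_def)

lemma ordinal_policy_map:
  assumes "length ds = t"
  shows "ordinal_policy \<theta> (map r [0..<Suc t]) ds =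
    return_pmf (if r t \<le> 2 \<and> leader r t \<in> unmatched ds \<and> \<theta> t then Some (leader r t) else None)"
proof -
  have "leader ((!) (map r [0..<Suc t])) t = leader r t"
    by (rule leader_cong) (simp add: nth_append)
  then show ?thesis
    using assms by (simp add: ordinal_policy_def Let_def nth_append del: upt_Suc)
qed

text \<open>\<open>\<theta>\<close> picks the larger term of the maximum in \<open>best\<close>;
  otherwise the policy stays idle and a newcomer that takes the lead is free.\<close>

lemma phase_at_step_eq_best:
  assumes v: "\<theta> \<longleftrightarrow> v Leader_Free \<le> v Pair_Joined"
    and t: "length ds = t" and ds: "past_partners ds" and r: "r t \<in> {1..Suc t}"
    and d: "d = (if r t \<le> 2 \<and> leader r t \<in> unmatched ds \<and> \<theta> then Some (leader r t) else None)"
  shows "v (phase_at r (ds @ [d]) (Suc t)) = best v (r t) (phase_at r ds t)"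
proof (cases "t = 0")
  case True
  then show ?thesis
    using t d r by (auto simp: phase_at_def unmatched_def)
next
  case False
  let ?l = "leader r t"
  have l: "?l < length ds"
    using False t by (simp add: leader_less)
  have J: "joined r (ds @ [d]) (Suc t) = (if r t \<le> 2 then d = Some ?l else joined r ds t)"
    using t by (simp add: nth_append joined_append)
  have U: "?l \<in> unmatched (ds @ [d]) \<longleftrightarrow> ?l \<in> unmatched ds \<and> d \<noteq> Some ?l"
      "t \<in> unmatched (ds @ [d]) \<longleftrightarrow> d = None"
    using l ds t unmatched_snoc_iff unmatched_snoc_length by blast+
  show ?thesis
  proof (cases "?l \<in> unmatched ds")
    case True
    then have "\<not> joined r ds t"
      using joined_imp_leader_matched[of r ds t] t by auto
    show ?thesis
    proof (cases "r t \<le> 2 \<and> \<theta>")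
      case match: True
      then have "d = Some ?l"
        using d True by simp
      then have "phase_at r (ds @ [d]) (Suc t) = Pair_Joined"
        using J U match by (simp add: phase_at_def)
      then show ?thesis
        using True match v by (simp add: phase_at_def)
    next
      case no_match: False
      then have "d = None"
        using d by auto
      then have "phase_at r (ds @ [d]) (Suc t) = Leader_Free"
        using U True by (simp add: phase_at_def)
      then show ?thesis
        using True no_match v by (auto simp: phase_at_def)
    qed
  next
    case False
    then have "d = None"
      using d by simp
    then show ?thesis
      using J U False r by (auto simp: phase_at_def simp del: joined.simps)
  qed
qed

text \<open>After time \<open>t\<close> there remain \<open>n - Suc t\<close> arrivals, so the test
  compares the two continuation values; a tie is decided for matching.\<close>

definition threshold_policy :: "nat \<Rightarrow> nat policy" where
  "threshold_policy n =
     ordinal_policy (\<lambda>t. opt n (n - Suc t) Leader_Free \<le> opt n (n - Suc t) Pair_Joined)"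

text \<open>Backward induction: the decision at time \<open>t\<close> depends only on ranks up to
  \<open>t\<close>, so it is constant while later ranks are averaged.\<close>

lemma gain_threshold_policy:
  assumes "length ds = t" "t + k = n" "past_partners ds"
  shows "rank_average k t (\<lambda>r. gain (threshold_policy n) r (\<lambda>ds. of_bool (joined r ds n)) k ds) r =
    opt n k (phase_at r ds t)"
  using assms
proof (induction k arbitrary: ds t r)
  case 0
  then show ?case
    using joined_imp_leader_matched[of r ds n] by (auto simp: phase_at_def)
next
  case (Suc k)
  let ?g = "\<lambda>k ds r. gain (threshold_policy n) r (\<lambda>ds. of_bool (joined r ds n)) k ds"
  let ?\<theta> = "opt n k Leader_Free \<le> opt n k Pair_Joined"
  have "rank_average k (Suc t) (?g (Suc k) ds) (r(t := j)) = best (opt n k) j (phase_at r ds t)"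
    if j: "j \<in> {1..Suc t}" for j
  proof -
    define r1 where "r1 = r(t := j)"
    have r1t: "r1 t = j"
      by (simp add: r1_def)
    define d where
      "d = (if r1 t \<le> 2 \<and> leader r1 t \<in> unmatched ds \<and> ?\<theta> then Some (leader r1 t) else None)"
    have "?g (Suc k) ds r' = ?g k (ds @ [d]) r'" if "\<And>i. i < Suc t \<Longrightarrow> r' i = r1 i" for r'
    proof -
      have "leader r' t = leader r1 t"
        using that by (intro leader_cong) simp
      moreover have "n - Suc t = k"
        using Suc.prems by simp
      ultimately show ?thesis
        using that[of t] Suc.prems(1)
        by (simp add: threshold_policy_def ordinal_policy_map d_def del: upt_Suc)
    qed
    then have "rank_average k (Suc t) (?g (Suc k) ds) r1 = rank_average k (Suc t) (?g k (ds @ [d])) r1"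
      by (intro rank_average_cong) auto
    also have "\<dots> = opt n k (phase_at r1 (ds @ [d]) (Suc t))"
    proof (rule Suc.IH)
      show "past_partners (ds @ [d])"
        using Suc.prems by (auto simp: past_partners_snoc d_def unmatched_def)
    qed (use Suc.prems in auto)
    also have "\<dots> = best (opt n k) (r1 t) (phase_at r1 ds t)"
      using Suc.prems j by (intro phase_at_step_eq_best[where \<theta> = ?\<theta>]) (simp_all add: d_def r1t)
    also have "phase_at r1 ds t = phase_at r ds t"
      by (intro phase_at_cong) (simp add: r1_def)
    finally show ?thesis
      by (simp only: r1_def fun_upd_same)
  qed
  then have "(\<Sum>j=1..Suc t. rank_average k (Suc t) (?g (Suc k) ds) (r(t := j))) =
      (\<Sum>j=1..Suc t. best (opt n k) j (phase_at r ds t))"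
    by (intro sum.cong refl)
  moreover have "n - k = Suc t"
    using Suc.prems by simp
  ultimately show ?case
    by (simp only: rank_average.simps opt.simps)
qed

text \<open>Here \<open>obs r\<close> may depend on the whole rank vector; \<open>stable\<close>
  only controls the probabilities rounded down to multiples of \<open>1 / K\<close>. Rounding costs
  at most \<open>1 / K\<close> per possible decision, so \<open>n / K\<close> per arrival, and the
  rounded rule mixes decisions none of which beats \<open>best\<close>.\<close>

lemma gain_le_opt:
  assumes A: "online_algorithm n A" and K: "0 < K"
    and stable: "\<And>r r' t ds d. t < n \<Longrightarrow> length ds = t \<Longrightarrow>
      (\<And>i. i < n \<Longrightarrow> r i \<in> {1..Suc i}) \<Longrightarrow> (\<And>i. i < n \<Longrightarrow> r' i \<in> {1..Suc i}) \<Longrightarrow>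
      (\<And>i. i \<le> t \<Longrightarrow> r i = r' i) \<Longrightarrow> past_partners ds \<Longrightarrow> d \<in> insert None (Some ` unmatched ds) \<Longrightarrow>
      \<lfloor>K * pmf (A (map (obs r) [0..<Suc t]) ds) d\<rfloor> =
      \<lfloor>K * pmf (A (map (obs r') [0..<Suc t]) ds) d\<rfloor>"
    and "length ds = t" "t + k = n" "\<And>i. i < t \<Longrightarrow> r i \<in> {1..Suc i}" "past_partners ds"
  shows "rank_average k t (\<lambda>r. gain A (obs r) (\<lambda>ds. of_bool (joined r ds n)) k ds) r \<le>
    opt n k (phase_at r ds t) + real k * (real n / K)"
  using assms(4-)
proof (induction k arbitrary: ds t r)
  case 0
  then show ?case
    using joined_imp_leader_matched[of r ds n] by (auto simp: phase_at_def)
next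
  case (Suc k)
  let ?g = "\<lambda>k ds r. gain A (obs r) (\<lambda>ds. of_bool (joined r ds n)) k ds"
  let ?e = "real k * (real n / K)"
  define D where "D = insert None (Some ` unmatched ds)"
  have t: "t < n"
    using Suc.prems by simp
  have "card (unmatched ds) \<le> card {..<t}"
    using Suc.prems(1) by (intro card_mono) (auto simp: unmatched_def)
  then have D: "finite D" "card D \<le> n"
    using t finite_unmatched by (auto simp: D_def card_insert_if card_image)
  have "rank_average k (Suc t) (?g (Suc k) ds) (r(t := j)) \<le>
      best (opt n k) j (phase_at r ds t) + (?e + real n / K)"
    if j: "j \<in> {1..Suc t}" for j
  proof -
    define r1 where "r1 = r(t := j)"
    \<comment> \<open>\<open>stable\<close> compares complete valid rank vectors;
      \<open>rref\<close> extends the ranks up to \<open>t\<close> by 1, a valid rank at any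
      time.\<close>
    define rref where "rref i = (if i \<le> t then r1 i else 1)" for i
    \<comment> \<open>By \<open>stable\<close>, these rounded probabilities depend only on the ranks up to time \<open>t\<close>,
      so they can be pulled out of the average over the later ranks.\<close>
    define q where "q d = \<lfloor>K * pmf (A (map (obs rref) [0..<Suc t]) ds) d\<rfloor> / K" for d
    define B where "B = best (opt n k) j (phase_at r ds t)"
    have r1: "r1 i \<in> {1..Suc i}" if "i \<le> t" for i
      using Suc.prems(3)[of i] that j by (auto simp: r1_def)
    have q_nonneg: "0 \<le> q d" for d
      using K by (simp add: q_def)
    have supp: "set_pmf (A (map (obs r') [0..<Suc t]) ds) \<subseteq> D" for r'
      unfolding D_def using Suc.prems t by (intro online_algorithmD[OF A]) auto
    have "q d \<le> pmf (A (map (obs rref) [0..<Suc t]) ds) d" for d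
      using K of_int_floor_le[of "K * pmf (A (map (obs rref) [0..<Suc t]) ds) d"]
      by (simp add: q_def divide_le_eq mult.commute del: upt_Suc)
    then have "sum q D \<le> (\<Sum>d\<in>D. pmf (A (map (obs rref) [0..<Suc t]) ds) d)"
      by (intro sum_mono)
    then have q_sum: "sum q D \<le> 1"
      using sum_pmf_eq_1[OF D(1) supp] by simp
    have B: "0 \<le> B"
      by (simp add: B_def best_nonneg opt_nonneg)
    have e: "0 \<le> ?e"
      using K by simp
    have "?g (Suc k) ds r' \<le> (\<Sum>d\<in>D. q d * ?g k (ds @ [d]) r') + real n / K"
      if r': "\<And>i. i < Suc t \<Longrightarrow> r' i = r1 i"
        "\<And>i. Suc t \<le> i \<Longrightarrow> i < Suc t + k \<Longrightarrow> r' i \<in> {1..Suc i}" for r'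
    proof -
      let ?p = "pmf (A (map (obs r') [0..<Suc t]) ds)"
      have valid: "r' i \<in> {1..Suc i}" if "i < n" for i
        using r'(1)[of i] r'(2)[of i] r1[of i] that Suc.prems by (cases "i \<le> t") auto
      have p: "?p d \<le> q d + 1 / K" if "d \<in> D" for d
      proof -
        have "\<lfloor>K * ?p d\<rfloor> = \<lfloor>K * pmf (A (map (obs rref) [0..<Suc t]) ds) d\<rfloor>"
          using t Suc.prems(1,4) valid r1 r'(1) that
          by (intro stable) (auto simp: rref_def D_def)
        then have "K * ?p d \<le> K * q d + 1"
          using K by (simp add: q_def del: upt_Suc) linarith
        then show ?thesis
          using K by (simp add: field_simps del: upt_Suc)
      qed
      have g: "?g k (ds @ [d]) r' \<in> {0..1}" for d
        using Suc.prems by (intro gain_bounds[OF A]) auto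
      have "?g (Suc k) ds r' = (\<Sum>d\<in>D. ?g k (ds @ [d]) r' * ?p d)"
        unfolding gain.simps Suc.prems(1)
        using supp by (intro integral_measure_pmf_real D) auto
      also have "\<dots> \<le> (\<Sum>d\<in>D. q d * ?g k (ds @ [d]) r' + 1 / K)"
      proof (rule sum_mono)
        fix d assume "d \<in> D"
        have "?g k (ds @ [d]) r' * ?p d \<le> ?g k (ds @ [d]) r' * (q d + 1 / K)"
          using p[OF \<open>d \<in> D\<close>] g[of d] by (intro mult_left_mono) auto
        also have "\<dots> \<le> q d * ?g k (ds @ [d]) r' + 1 / K"
          using mult_right_mono[of "?g k (ds @ [d]) r'" 1 "1 / K"] g[of d] K
          by (simp add: algebra_simps)
        finally show "?g k (ds @ [d]) r' * ?p d \<le> q d * ?g k (ds @ [d]) r' + 1 / K" .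
      qed
      also have "\<dots> = (\<Sum>d\<in>D. q d * ?g k (ds @ [d]) r') + real (card D) / K"
        by (simp add: sum.distrib)
      also have "real (card D) / K \<le> real n / K"
        using D(2) K by (intro divide_right_mono) auto
      finally show ?thesis
        by simp
    qed
    then have "rank_average k (Suc t) (?g (Suc k) ds) r1 \<le>
        rank_average k (Suc t) (\<lambda>r'. (\<Sum>d\<in>D. q d * ?g k (ds @ [d]) r') + real n / K) r1"
      by (intro rank_average_mono) blast
    also have "\<dots> = (\<Sum>d\<in>D. q d * rank_average k (Suc t) (?g k (ds @ [d])) r1) + real n / K"
      by (simp only: rank_average_add_const rank_average_sum)
    also have "(\<Sum>d\<in>D. q d * rank_average k (Suc t) (?g k (ds @ [d])) r1) \<le>
        (\<Sum>d\<in>D. q d * (B + ?e))"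
    proof (intro sum_mono mult_left_mono q_nonneg)
      fix d assume "d \<in> D"
      have "rank_average k (Suc t) (?g k (ds @ [d])) r1 \<le>
          opt n k (phase_at r1 (ds @ [d]) (Suc t)) + ?e"
        using Suc.prems r1 \<open>d \<in> D\<close>
        by (intro Suc.IH) (auto simp: past_partners_snoc D_def unmatched_def)
      also have "opt n k (phase_at r1 (ds @ [d]) (Suc t)) \<le> best (opt n k) (r1 t) (phase_at r1 ds t)"
        using Suc.prems(1) r1 \<open>d \<in> D\<close>
        by (intro phase_at_step_le_best opt_Leader_Taken_le) (auto simp: D_def)
      also have "best (opt n k) (r1 t) (phase_at r1 ds t) = B"
        using phase_at_cong[of t r1 r ds] by (simp add: B_def r1_def)
      finally show "rank_average k (Suc t) (?g k (ds @ [d])) r1 \<le> B + ?e"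
        by simp
    qed
    \<comment> \<open>Rounding down leaves total mass at most 1, and \<open>B + ?e\<close> is
      nonnegative.\<close>
    also have "(\<Sum>d\<in>D. q d * (B + ?e)) \<le> B + ?e"
      using mult_right_mono[OF q_sum, of "B + ?e"] B e by (simp add: sum_distrib_right)
    finally show ?thesis
      by (simp only: r1_def B_def add.assoc)
  qed
  then have "rank_average (Suc k) t (?g (Suc k) ds) r \<le>
      (\<Sum>j=1..Suc t. best (opt n k) j (phase_at r ds t) + (?e + real n / K)) / real (Suc t)"
    unfolding rank_average.simps by (intro divide_right_mono sum_mono) auto
  also have "\<dots> = (\<Sum>j=1..Suc t. best (opt n k) j (phase_at r ds t)) / real (Suc t) +
      (?e + real n / K)"
    by (simp only: sum.distrib sum_constant card_atLeastAtMost add_divide_distrib) simp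
  also have "(\<Sum>j=1..Suc t. best (opt n k) j (phase_at r ds t)) / real (Suc t) =
      opt n (Suc k) (phase_at r ds t)"
  proof -
    have "n - k = Suc t"
      using Suc.prems by simp
    then show ?thesis
      by (simp only: opt.simps)
  qed
  also have "?e + real n / K = real (Suc k) * (real n / K)"
    by (simp add: distrib_right add_divide_distrib)
  finally show ?case .
qed

section \<open>Success probabilities as averages over rank vectors\<close>

lemma gain_cong:
  assumes "\<And>i. i < length ds + k \<Longrightarrow> obs i = obs' i"
  shows "gain A obs F k ds = gain A obs' F k ds"
  using assms
proof (induction k arbitrary: ds)
  case (Suc k)
  have "map obs [0..<Suc (length ds)] = map obs' [0..<Suc (length ds)]"
    using Suc.prems by (intro map_cong) auto
  moreover have "gain A obs F k (ds @ [d]) = gain A obs' F k (ds @ [d])" for d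
    using Suc.prems by (intro Suc.IH) simp
  ultimately show ?case
    by (simp only: gain.simps)
qed simp

lemma set_pmf_random_matching:
  assumes "online_algorithm n A"
  shows "finite (set_pmf (random_matching n A obs))"
    and "M \<in> set_pmf (random_matching n A obs) \<Longrightarrow>
      \<exists>\<pi> ds. \<pi> permutes {..<n} \<and> length ds = n \<and> past_partners ds \<and> M = matched_edges \<pi> ds"
proof -
  let ?P = "{\<pi>. \<pi> permutes {..<n}}"
  have P: "set_pmf (pmf_of_set ?P) = ?P"
    by (intro set_pmf_of_set) (auto intro: permutes_id simp: finite_permutations)
  show "finite (set_pmf (random_matching n A obs))"
    using set_pmf_run(1)[OF assms order_refl]
    by (simp add: random_matching_def P finite_permutations)
  show "\<exists>\<pi> ds. \<pi> permutes {..<n} \<and> length ds = n \<and> past_partners ds \<and> M = matched_edges \<pi> ds"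
    if "M \<in> set_pmf (random_matching n A obs)"
    using that set_pmf_run(2)[OF assms order_refl] by (auto simp: random_matching_def P)
qed

text \<open>The observations are arbitrary, so this serves the ordinal policy and the cardinal
  algorithm alike.\<close>

lemma prob_top_edge_matched:
  assumes A: "online_algorithm n A" and \<rho>: "ranking n \<rho>" and "0 < n"
  shows "measure_pmf.prob (random_matching n A obs) {M. {v. v < n \<and> \<rho> v \<le> 2} \<in> M} =
    (\<Sum>\<pi> | \<pi> permutes {..<n}.
       gain A (obs \<pi>) (\<lambda>ds. of_bool (joined (relative_rank \<rho> \<pi>) ds n)) n []) / fact n"
proof -
  let ?S = "{M. {v. v < n \<and> \<rho> v \<le> 2} \<in> M}"
  have *: "measure_pmf.expectation (run A (obs \<pi>) n) (\<lambda>ds. indicator ?S (matched_edges \<pi> ds)) =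
      gain A (obs \<pi>) (\<lambda>ds. of_bool (joined (relative_rank \<rho> \<pi>) ds n)) n []"
    if \<pi>: "\<pi> permutes {..<n}" for \<pi>
  proof -
    have "measure_pmf.expectation (run A (obs \<pi>) n) (\<lambda>ds. indicator ?S (matched_edges \<pi> ds)) =
        measure_pmf.expectation (run A (obs \<pi>) n)
          (\<lambda>ds. of_bool (joined (relative_rank \<rho> \<pi>) ds n) :: real)"
    proof (intro integral_cong_AE AE_pmfI)
      fix ds assume "ds \<in> set_pmf (run A (obs \<pi>) n)"
      then show "indicator ?S (matched_edges \<pi> ds) =
          (of_bool (joined (relative_rank \<rho> \<pi>) ds n) :: real)"
        using top_edge_matched_iff[OF \<rho> \<pi> \<open>0 < n\<close>, of ds] set_pmf_run(2)[OF A order_refl]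
        by (simp add: indicator_def)
    qed auto
    also have "\<dots> = measure_pmf.expectation (run A (obs \<pi>) 0)
        (gain A (obs \<pi>) (\<lambda>ds. of_bool (joined (relative_rank \<rho> \<pi>) ds n)) n)"
      by (intro expectation_run_eq_gain[OF A]) simp
    finally show ?thesis
      by simp
  qed
  have "measure_pmf.expectation (random_matching n A obs) (indicator ?S) =
    (\<Sum>\<pi> | \<pi> permutes {..<n}.
       gain A (obs \<pi>) (\<lambda>ds. of_bool (joined (relative_rank \<rho> \<pi>) ds n)) n []) / fact n"
    unfolding expectation_random_matching[OF A]
    by (intro arg_cong2[of _ _ _ _ "(/)"] sum.cong refl *) simp
  then show ?thesis
    by simp
qed

lemma sum_permutations_relative_rank:
  assumes "ranking n \<rho>"
  shows "(\<Sum>\<pi> | \<pi> permutes {..<n}. F (restrict (relative_rank \<rho> \<pi>) {..<n})) / fact n =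
    rank_average n 0 F (\<lambda>_. undefined)"
  using sum.reindex_bij_betw[OF bij_betw_relative_ranks[OF assms], of F]
  by (simp add: rank_average_eq_sum)

definition opt_prob :: "nat \<Rightarrow> real" where
  "opt_prob n = opt n n Leader_Taken"

lemma phase_at_0: "phase_at r [] 0 = Leader_Taken"
  by (simp add: phase_at_def unmatched_def)

lemma success_prob_threshold_policy:
  assumes "ranking n \<rho>" "0 < n"
  shows "success_prob n \<rho> (threshold_policy n) = opt_prob n"
proof -
  let ?F = "\<lambda>r. gain (threshold_policy n) r (\<lambda>ds. of_bool (joined r ds n)) n []"
  \<comment> \<open>Only ranks at times below \<open>n\<close> matter, so the rank function may be
    replaced by a point of the product space.\<close>
  have "?F (relative_rank \<rho> \<pi>) = ?F (restrict (relative_rank \<rho> \<pi>) {..<n})" for \<pi>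
  proof -
    let ?r = "restrict (relative_rank \<rho> \<pi>) {..<n}"
    have "joined (relative_rank \<rho> \<pi>) ds n = joined ?r ds n" for ds
      by (rule joined_cong) simp
    then show ?thesis
      using gain_cong[of "[]" n "relative_rank \<rho> \<pi>" ?r] by simp
  qed
  then have "success_prob n \<rho> (threshold_policy n) =
      (\<Sum>\<pi> | \<pi> permutes {..<n}. ?F (restrict (relative_rank \<rho> \<pi>) {..<n})) / fact n"
    unfolding success_prob_def
    using assms by (simp add: prob_top_edge_matched threshold_policy_def online_ordinal_policy)
  also have "\<dots> = rank_average n 0 ?F (\<lambda>_. undefined)"
    by (rule sum_permutations_relative_rank[OF assms(1)])
  also have "\<dots> = opt_prob n"
    by (subst gain_threshold_policy) (simp_all add: phase_at_0 opt_prob_def past_partners_def)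
  finally show ?thesis .
qed

lemma bernoulli_pmf_of_bool: "bernoulli_pmf (of_bool b) = return_pmf b"
  by (rule pmf_eqI) (auto simp: pmf_bernoulli_True pmf_bernoulli_False split: split_indicator)

lemma top_two_binary_threshold_policy:
  "top_two_binary n
     (\<lambda>t. of_bool (opt n (n - Suc t) Leader_Free \<le> opt n (n - Suc t) Pair_Joined))
     (threshold_policy n)"
  unfolding top_two_binary_def
proof (intro conjI allI impI ballI)
  fix \<rho> \<pi> t and ds :: "nat option list"
  assume *: "ranking n \<rho> \<and> \<pi> permutes {..<n} \<and> t < n \<and> length ds = t"
  have pair: "top_two \<rho> \<pi> t = {s, t} \<longleftrightarrow>
      relative_rank \<rho> \<pi> t \<le> 2 \<and> s = leader (relative_rank \<rho> \<pi>) t" if "s \<in> unmatched ds" for s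
    using * that by (intro top_two_eq_pair_iff ranking_inj_on[of n]) (auto simp: unmatched_def)
  {
    fix s assume "s \<in> unmatched ds" "top_two \<rho> \<pi> t = {s, t}"
    then show "threshold_policy n (map (relative_rank \<rho> \<pi>) [0..<Suc t]) ds =
        map_pmf (\<lambda>b. if b then Some s else None)
          (bernoulli_pmf (of_bool (opt n (n - Suc t) Leader_Free \<le> opt n (n - Suc t) Pair_Joined)))"
      using pair[of s] *
      by (simp add: threshold_policy_def ordinal_policy_map bernoulli_pmf_of_bool
          del: upt_Suc of_bool_eq)
  next
    assume "\<nexists>s. s \<in> unmatched ds \<and> top_two \<rho> \<pi> t = {s, t}"
    then show "threshold_policy n (map (relative_rank \<rho> \<pi>) [0..<Suc t]) ds = return_pmf None"
      using pair * by (auto simp: threshold_policy_def ordinal_policy_map simp del: upt_Suc)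
  }
qed auto

subsection \<open>From weights to relative ranks\<close>

text \<open>All that the cardinal algorithm observes, as a function of the values in arrival order;
  these value lists are what Ramsey's theorem colours.\<close>

definition weights_of_values :: "real \<Rightarrow> nat list \<Rightarrow> real list list" where
  "weights_of_values q xs = map (\<lambda>t. map (\<lambda>s. q ^ (xs ! s + xs ! t)) [0..<t]) [0..<length xs]"

lemma revealed_weights_power:
  assumes "inj \<pi>"
  shows "map (revealed_weights (\<lambda>e. q ^ sum y e) \<pi>) [0..<Suc t] =
    weights_of_values q (map (y \<circ> \<pi>) [0..<Suc t])"
proof (rule nth_equalityI)
  fix u assume "u < length (map (revealed_weights (\<lambda>e. q ^ sum y e) \<pi>) [0..<Suc t])"
  then have u: "u < Suc t"
    by simp
  have nth: "map (y \<circ> \<pi>) [0..<Suc t] ! s = y (\<pi> s)" if "s < Suc t" for s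
    using nth_map_upt[of s "Suc t" 0] that by (simp del: upt_Suc)
  have "\<pi> s \<noteq> \<pi> u" if "s < u" for s
    using that assms by (auto dest: injD)
  then show "map (revealed_weights (\<lambda>e. q ^ sum y e) \<pi>) [0..<Suc t] ! u =
      weights_of_values q (map (y \<circ> \<pi>) [0..<Suc t]) ! u"
    using u nth by (auto simp: weights_of_values_def revealed_weights_def simp del: upt_Suc)
qed (simp add: weights_of_values_def)

lemma same_pattern_values:
  assumes \<pi>: "\<pi> permutes {..<n}" "\<pi>' permutes {..<n}" and y: "strict_mono y" and "t < n"
    and eq: "\<And>i. i \<le> t \<Longrightarrow> relative_rank Suc \<pi> i = relative_rank Suc \<pi>' i"
  shows "same_pattern (map (y \<circ> \<pi>) [0..<Suc t]) (map (y \<circ> \<pi>') [0..<Suc t])"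
proof -
  have "inj_on (Suc \<circ> \<pi>) {..t}" "inj_on (Suc \<circ> \<pi>') {..t}"
    using \<pi>[THEN permutes_inj] inj_compose[OF inj_Suc] by (blast intro: inj_on_subset)+
  then have rank: "rank_among Suc \<pi> t i = rank_among Suc \<pi>' t i" if "i \<le> t" for i
    using eq that by (rule rank_among_cong_relative_rank)
  have "\<pi> i < \<pi> j \<longleftrightarrow> \<pi>' i < \<pi>' j" if "i \<le> t" "j \<le> t" for i j
    using rank_among_less_iff[OF that, of Suc \<pi>] rank_among_less_iff[OF that, of Suc \<pi>'] rank that
    by simp
  moreover have "map (y \<circ> \<sigma>) [0..<Suc t] ! i = y (\<sigma> i)" if "i \<le> t" for i \<sigma>
    using nth_map_upt[of i "Suc t" 0] that by (simp del: upt_Suc)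
  ultimately show ?thesis
    using strict_mono_less[OF y] by (auto simp: same_pattern_def less_Suc_eq_le simp del: upt_Suc)
qed

text \<open>Colour a value list by the table of rounded probabilities over all histories of length
  at most \<open>n\<close> and all decisions; rounding leaves finitely many tables. Enumerating the
  set from \<open>Ramsey_order_pattern\<close> gives \<open>y\<close>, and equal relative ranks give
  equal patterns.\<close>

lemma exists_values_canonical:
  assumes "0 < K"
  shows "\<exists>y. strict_mono y \<and> (\<forall>\<pi> \<pi>' t ds d. \<pi> permutes {..<n} \<longrightarrow> \<pi>' permutes {..<n} \<longrightarrow> t < n \<longrightarrow>
    (\<forall>i\<le>t. relative_rank Suc \<pi> i = relative_rank Suc \<pi>' i) \<longrightarrow>
    length ds = t \<longrightarrow> past_partners ds \<longrightarrow> d \<in> insert None (Some ` unmatched ds) \<longrightarrow>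
    \<lfloor>K * pmf (A (weights_of_values q (map (y \<circ> \<pi>) [0..<Suc t])) ds) d\<rfloor> =
    \<lfloor>K * pmf (A (weights_of_values q (map (y \<circ> \<pi>') [0..<Suc t])) ds) d\<rfloor>)"
proof -
  define N where "N = insert None (Some ` {..<n})"
  define I where "I = {ds. set ds \<subseteq> N \<and> length ds \<le> n} \<times> N"
  define c where "c xs = (\<lambda>(ds, d)\<in>I. \<lfloor>K * pmf (A (weights_of_values q xs) ds) d\<rfloor>)" for xs
  have "finite I"
    by (auto simp: I_def N_def intro!: finite_lists_length_le)
  then have fin: "finite (I \<rightarrow>\<^sub>E {0..\<lfloor>K\<rfloor>})"
    by (intro finite_PiE) auto
  have "K * pmf p d \<le> K" for p :: "nat option pmf" and d
    using mult_left_mono[OF pmf_le_1[of p d], of K] assms by simp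
  then have c: "c xs \<in> I \<rightarrow>\<^sub>E {0..\<lfloor>K\<rfloor>}" for xs
    using assms by (auto simp: c_def intro!: floor_mono)
  obtain Y where Y: "infinite Y" and
    canonical: "\<And>xs ys. distinct xs \<Longrightarrow> length xs \<le> n \<Longrightarrow> set xs \<subseteq> Y \<Longrightarrow> set ys \<subseteq> Y \<Longrightarrow>
      same_pattern xs ys \<Longrightarrow> c xs = c ys"
    using Ramsey_order_pattern[of _ c, OF fin c] by blast
  define y where "y = enumerate Y"
  have y: "strict_mono y" "range y = Y"
    using Y by (auto simp: y_def strict_mono_enumerate range_enumerate)
  have "\<lfloor>K * pmf (A (weights_of_values q (map (y \<circ> \<pi>) [0..<Suc t])) ds) d\<rfloor> =
      \<lfloor>K * pmf (A (weights_of_values q (map (y \<circ> \<pi>') [0..<Suc t])) ds) d\<rfloor>"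
    if \<pi>: "\<pi> permutes {..<n}" "\<pi>' permutes {..<n}" and t: "t < n"
      and eq: "\<forall>i\<le>t. relative_rank Suc \<pi> i = relative_rank Suc \<pi>' i"
      and ds: "length ds = t" "past_partners ds" "d \<in> insert None (Some ` unmatched ds)"
    for \<pi> \<pi>' t ds d
  proof -
    have "inj (y \<circ> \<pi>)"
      using strict_mono_imp_inj_on[OF y(1)] permutes_inj[OF \<pi>(1)] by (rule inj_compose)
    then have "inj_on (y \<circ> \<pi>) (set [0..<Suc t])"
      by (rule inj_on_subset) (rule subset_UNIV)
    then have "distinct (map (y \<circ> \<pi>) [0..<Suc t])"
      by (simp only: distinct_map distinct_upt simp_thms)
    then have "c (map (y \<circ> \<pi>) [0..<Suc t]) = c (map (y \<circ> \<pi>') [0..<Suc t])"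
      using t eq y by (intro canonical same_pattern_values[OF \<pi> y(1)]) (auto simp del: upt_Suc)
    then have "c (map (y \<circ> \<pi>) [0..<Suc t]) (ds, d) = c (map (y \<circ> \<pi>') [0..<Suc t]) (ds, d)"
      by simp
    moreover have "(ds, d) \<in> I"
    proof -
      have "x \<in> N" if x: "x \<in> set ds" for x
      proof (cases x)
        case (Some s)
        then obtain u where "u < t" "ds ! u = Some s"
          using x ds(1) by (auto simp: in_set_conv_nth)
        then have "s < u"
          using ds by (simp add: past_partners_def)
        then show ?thesis
          using Some \<open>u < t\<close> t by (simp add: N_def)
      qed (simp add: N_def)
      then show ?thesis
        using ds t by (auto simp: I_def N_def unmatched_def)
    qed
    ultimately show ?thesis
      by (simp add: c_def del: upt_Suc)
  qed
  then show ?thesis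
    using y(1) by blast
qed

lemma ranking_Suc: "ranking n Suc"
  by (simp add: ranking_def bij_betw_def image_Suc_lessThan)

lemma exists_values_top_edge_le:
  assumes A: "online_algorithm n A" and "0 < n" "0 < K"
  shows "\<exists>y. strict_mono y \<and>
    measure_pmf.prob (random_matching n A (revealed_weights (\<lambda>e. q ^ sum y e)))
      {M. {v. v < n \<and> Suc v \<le> 2} \<in> M} \<le> opt_prob n + real n * (real n / K)"
proof -
  let ?P = "{\<pi>. \<pi> permutes {..<n}}"
  define f where "f \<pi> = restrict (relative_rank Suc \<pi>) {..<n}" for \<pi>
  \<comment> \<open>\<open>perm\<close> decodes a rank vector into its arrival order, so that the
    revealed weights become a function of the rank vector, as in \<open>gain_le_opt\<close>.\<close>
  define perm where "perm r = inv_into ?P f (restrict r {..<n})" for r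
  have f: "bij_betw f ?P (\<Pi>\<^sub>E i\<in>{..<n}. {1..Suc i})"
    unfolding f_def by (rule bij_betw_relative_ranks[OF ranking_Suc])
  obtain y where y: "strict_mono y" and stable:
    "\<And>\<pi> \<pi>' t ds d. \<pi> permutes {..<n} \<Longrightarrow> \<pi>' permutes {..<n} \<Longrightarrow> t < n \<Longrightarrow>
      (\<And>i. i \<le> t \<Longrightarrow> relative_rank Suc \<pi> i = relative_rank Suc \<pi>' i) \<Longrightarrow>
      length ds = t \<Longrightarrow> past_partners ds \<Longrightarrow> d \<in> insert None (Some ` unmatched ds) \<Longrightarrow>
      \<lfloor>K * pmf (A (weights_of_values q (map (y \<circ> \<pi>) [0..<Suc t])) ds) d\<rfloor> =
      \<lfloor>K * pmf (A (weights_of_values q (map (y \<circ> \<pi>') [0..<Suc t])) ds) d\<rfloor>"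
    using exists_values_canonical[OF \<open>0 < K\<close>, of n A q] by blast
  define obs where "obs r = revealed_weights (\<lambda>e. q ^ sum y e) (perm r)" for r
  let ?F = "\<lambda>r. gain A (obs r) (\<lambda>ds. of_bool (joined r ds n)) n []"
  have perm: "perm r permutes {..<n}" "\<And>i. i < n \<Longrightarrow> relative_rank Suc (perm r) i = r i"
    if r: "\<And>i. i < n \<Longrightarrow> r i \<in> {1..Suc i}" for r
  proof -
    have "restrict r {..<n} \<in> f ` ?P"
      using r bij_betw_imp_surj_on[OF f] by auto
    then have "perm r \<in> ?P" "f (perm r) = restrict r {..<n}"
      unfolding perm_def by (rule inv_into_into, rule f_inv_into_f)
    then show "perm r permutes {..<n}" "\<And>i. i < n \<Longrightarrow> relative_rank Suc (perm r) i = r i"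
      by (auto simp: f_def dest: fun_cong split: if_splits)
  qed
  have "gain A (revealed_weights (\<lambda>e. q ^ sum y e) \<pi>)
      (\<lambda>ds. of_bool (joined (relative_rank Suc \<pi>) ds n)) n [] = ?F (f \<pi>)"
    if "\<pi> permutes {..<n}" for \<pi>
  proof -
    have "restrict (f \<pi>) {..<n} = f \<pi>"
      by (auto simp: f_def)
    then have "perm (f \<pi>) = \<pi>"
      using that bij_betw_imp_inj_on[OF f] by (simp add: perm_def inv_into_f_f)
    moreover have "joined (relative_rank Suc \<pi>) ds n = joined (f \<pi>) ds n" for ds
      by (rule joined_cong) (simp add: f_def)
    ultimately show ?thesis
      by (simp add: obs_def)
  qed
  then have "measure_pmf.prob (random_matching n A (revealed_weights (\<lambda>e. q ^ sum y e)))
      {M. {v. v < n \<and> Suc v \<le> 2} \<in> M} = (\<Sum>\<pi>\<in>?P. ?F (f \<pi>)) / fact n"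
    by (simp only: prob_top_edge_matched[OF A ranking_Suc \<open>0 < n\<close>]) simp
  also have "\<dots> = rank_average n 0 ?F (\<lambda>_. undefined)"
    unfolding f_def by (rule sum_permutations_relative_rank[OF ranking_Suc])
  also have "\<dots> \<le> opt n n (phase_at (\<lambda>_. undefined) [] 0) + real n * (real n / K)"
  proof (rule gain_le_opt[OF A \<open>0 < K\<close>])
    fix r r' :: "nat \<Rightarrow> nat" and t and ds :: "nat option list" and d
    assume ds: "t < n" "length ds = t" "past_partners ds" "d \<in> insert None (Some ` unmatched ds)"
      and r: "\<And>i. i < n \<Longrightarrow> r i \<in> {1..Suc i}" "\<And>i. i < n \<Longrightarrow> r' i \<in> {1..Suc i}"
      and eq: "\<And>i. i \<le> t \<Longrightarrow> r i = r' i"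
    have perms: "perm r permutes {..<n}" "perm r' permutes {..<n}"
      using r by (blast intro: perm(1))+
    have "relative_rank Suc (perm r) i = relative_rank Suc (perm r') i" if "i \<le> t" for i
      using perm(2)[OF r(1), of i] perm(2)[OF r(2), of i] eq[OF that] that ds(1) by simp
    from stable[OF perms ds(1) this ds(2-4)]
    show "\<lfloor>K * pmf (A (map (obs r) [0..<Suc t]) ds) d\<rfloor> =
        \<lfloor>K * pmf (A (map (obs r') [0..<Suc t]) ds) d\<rfloor>"
      by (simp only: obs_def revealed_weights_power perms[THEN permutes_inj])
  qed (auto simp: past_partners_def)
  finally show ?thesis
    using y by (auto simp: phase_at_0 opt_prob_def)
qed

section \<open>Dominance of the top edge\<close>

lemma matched_edges_finite_card:
  assumes "length ds = n"
  shows "finite (matched_edges \<pi> ds)" "card (matched_edges \<pi> ds) \<le> n"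
proof -
  \<comment> \<open>Each matched edge is named by the time of a decision that made it.\<close>
  have sub: "matched_edges \<pi> ds \<subseteq> (\<lambda>t. {\<pi> (the (ds ! t)), \<pi> t}) ` {..<n}"
  proof
    fix e assume "e \<in> matched_edges \<pi> ds"
    then obtain s t where "t < n" "ds ! t = Some s" "e = {\<pi> s, \<pi> t}"
      using assms by (auto simp: matched_edges_def)
    then show "e \<in> (\<lambda>t. {\<pi> (the (ds ! t)), \<pi> t}) ` {..<n}"
      by (intro image_eqI[of _ _ t]) simp_all
  qed
  then show "finite (matched_edges \<pi> ds)"
    by (rule finite_subset) simp
  have "card (matched_edges \<pi> ds) \<le> card ((\<lambda>t. {\<pi> (the (ds ! t)), \<pi> t}) ` {..<n})"
    using sub by (intro card_mono) simp_all
  also have "\<dots> \<le> n"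
    using card_image_le[of "{..<n}" "\<lambda>t. {\<pi> (the (ds ! t)), \<pi> t}"] by simp
  finally show "card (matched_edges \<pi> ds) \<le> n" .
qed

text \<open>In a pair other than \<open>{0, 1}\<close> the larger vertex is at least 2, so its value
  exceeds \<open>y 1\<close>, while the other value is at least \<open>y 0\<close>. Integrality
  yields one more factor \<open>q\<close>.\<close>

lemma power_weight_le:
  fixes q :: real and y :: "nat \<Rightarrow> nat"
  assumes y: "strict_mono y" and q: "0 < q" "q \<le> 1" and uv: "u \<noteq> v" "{u, v} \<noteq> {0, 1}"
  shows "q ^ sum y {u, v} \<le> q ^ sum y {0, 1} * q"
proof -
  have *: "y 0 + y 1 + 1 \<le> y u + y v" if "u < v" "{u, v} \<noteq> {0, 1}" for u v :: nat
  proof -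
    have "2 \<le> v"
      using that by (cases v; cases "v - 1") auto
    then have "y 1 < y v" "y 0 \<le> y u"
      using strict_monoD[OF y, of 1 v] strict_mono_less_eq[OF y, of 0 u] by auto
    then show ?thesis
      by simp
  qed
  have "y 0 + y 1 + 1 \<le> y u + y v"
    using *[of u v] *[of v u] uv by (cases "u < v") (auto simp: insert_commute)
  then have "q ^ (y u + y v) \<le> q ^ (y 0 + y 1 + 1)"
    using q by (intro power_decreasing) auto
  then show ?thesis
    using uv by (simp add: power_add mult.commute)
qed

text \<open>The edge \<open>{0, 1}\<close> alone is a matching of weight \<open>W\<close>, so the
  algorithm earns at least \<open>\<alpha> * W\<close>. It earns at most \<open>W\<close> from this
  edge and at most \<open>W * q\<close> from each of at most \<open>n\<close> others; divide by
  \<open>W\<close>.\<close>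

lemma competitive_le_top_edge_prob:
  assumes A: "online_algorithm n A" and comp: "competitive n \<alpha> A" and "0 \<le> \<alpha>" "2 \<le> n"
    and y: "strict_mono y" and q: "0 < q" "q \<le> 1"
  shows "\<alpha> \<le> measure_pmf.prob (random_matching n A (revealed_weights (\<lambda>e. q ^ sum y e)))
    {M. {v. v < n \<and> Suc v \<le> 2} \<in> M} + real n * q"
proof -
  define w where "w e = q ^ sum y e" for e
  let ?R = "random_matching n A (revealed_weights w)"
  let ?S = "{M. {0::nat, 1} \<in> M}"
  define W where "W = w {0, 1}"
  have W: "0 < W"
    using q by (simp add: W_def w_def)
  have top: "{v. v < n \<and> Suc v \<le> 2} = {0, 1}"
    using \<open>2 \<le> n\<close> by auto
  have fin: "finite (set_pmf ?R)"
    by (rule set_pmf_random_matching(1)[OF A])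
  have "{{0, 1}} \<in> matchings n"
    using \<open>2 \<le> n\<close> by (auto simp: matchings_def complete_edges_def disjoint_def)
  moreover have "finite (matchings n)"
    by (rule finite_subset[of _ "Pow (Pow {..<n})"]) (auto simp: matchings_def complete_edges_def)
  ultimately have "(\<Sum>e\<in>{{0, 1}}. w e) \<le> max_matching_weight n w"
    unfolding max_matching_weight_def by (intro Max_ge finite_imageI imageI)
  then have "\<alpha> * W \<le> \<alpha> * max_matching_weight n w"
    using \<open>0 \<le> \<alpha>\<close> by (intro mult_left_mono) (simp_all add: W_def)
  also have "\<dots> \<le> measure_pmf.expectation ?R (\<lambda>M. \<Sum>e\<in>M. w e)"
    using q by (intro comp[unfolded competitive_def, rule_format]) (simp add: w_def)
  also have "\<dots> \<le> measure_pmf.expectation ?R (\<lambda>M. W * (indicator ?S M + real n * q))"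
  proof (intro integral_mono_AE integrable_measure_pmf_finite[OF fin] AE_pmfI)
    fix M assume "M \<in> set_pmf ?R"
    then obtain \<pi> ds where \<pi>: "\<pi> permutes {..<n}" and ds: "length ds = n" "past_partners ds"
      and M: "M = matched_edges \<pi> ds"
      using set_pmf_random_matching(2)[OF A] by blast
    have M_fin: "finite M" "card M \<le> n"
      using matched_edges_finite_card[OF ds(1)] M by auto
    have "w e \<le> W * of_bool (e = {0, 1}) + W * q" if e: "e \<in> M" for e
    proof (cases "e = {0, 1}")
      case True
      then show ?thesis
        using W q by (simp add: W_def)
    next
      case False
      obtain s t where st: "t < n" "ds ! t = Some s" "e = {\<pi> s, \<pi> t}"
        using e ds(1) by (auto simp: M matched_edges_def)
      then have "s \<noteq> t"
        using ds by (auto simp: past_partners_def)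
      then have "\<pi> s \<noteq> \<pi> t"
        using permutes_inj[OF \<pi>] by (auto dest: injD)
      then show ?thesis
        using power_weight_le[OF y q] False st by (simp add: W_def w_def)
    qed
    then have "(\<Sum>e\<in>M. w e) \<le> (\<Sum>e\<in>M. W * of_bool (e = {0, 1}) + W * q)"
      by (rule sum_mono)
    also have "\<dots> = W * (\<Sum>e\<in>M. of_bool (e = {0, 1})) + real (card M) * (W * q)"
      by (simp only: sum.distrib sum_distrib_left[symmetric] sum_constant mult.left_commute)
    also have "(\<Sum>e\<in>M. of_bool (e = {0, 1})) = (indicator ?S M :: real)"
      using M_fin(1) by (simp add: of_bool_def indicator_def)
    also have "W * indicator ?S M + real (card M) * (W * q) \<le> W * indicator ?S M + real n * (W * q)"
      using M_fin(2) W q by (intro add_left_mono mult_right_mono) auto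
    finally show "(\<Sum>e\<in>M. w e) \<le> W * (indicator ?S M + real n * q)"
      by (simp add: algebra_simps)
  qed
  also have "\<dots> = W * (measure_pmf.prob ?R ?S + real n * q)"
    by (simp add: Bochner_Integration.integral_add integrable_measure_pmf_finite[OF fin])
  finally have "\<alpha> \<le> measure_pmf.prob ?R ?S + real n * q"
    using W by (simp add: mult.commute)
  then show ?thesis
    unfolding top w_def .
qed

section \<open>Choice of parameters and conclusion\<close>

lemma competitive_le_opt_prob:
  assumes A: "online_algorithm n A" and comp: "competitive n \<alpha> A" and "0 \<le> \<alpha>" "2 \<le> n"
  shows "\<alpha> \<le> opt_prob n + 2 / real n"
proof -
  \<comment> \<open>With \<open>q = 1 / n^2\<close> and \<open>K = n^3\<close> both errors,
    \<open>n * q\<close> from the lighter edges and \<open>n * (n / K)\<close> from rounding, equal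
    \<open>1 / n\<close>.\<close>
  have n: "0 < n" "0 < real n ^ 3" "0 < 1 / real n ^ 2" "1 / real n ^ 2 \<le> 1"
    using \<open>2 \<le> n\<close> by simp_all
  obtain y where y: "strict_mono y" and
    le: "measure_pmf.prob (random_matching n A (revealed_weights (\<lambda>e. (1 / real n ^ 2) ^ sum y e)))
      {M. {v. v < n \<and> Suc v \<le> 2} \<in> M} \<le> opt_prob n + real n * (real n / real n ^ 3)"
    using exists_values_top_edge_le[OF A n(1,2)] by blast
  have "\<alpha> \<le> opt_prob n + real n * (real n / real n ^ 3) + real n * (1 / real n ^ 2)"
    using competitive_le_top_edge_prob[OF A comp assms(3,4) y n(3,4)] le by linarith
  also have "\<dots> = opt_prob n + 2 / real n"
    using n(1) by (simp add: field_simps power2_eq_square power3_eq_cube)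
  finally show ?thesis .
qed

theorem theorem8:
  "\<exists>C::real. C > 0 \<and>
     (\<forall>(n::nat) (\<alpha>::real) (ALG :: real list policy).
        n \<ge> 2 \<longrightarrow> online_algorithm n ALG \<longrightarrow> competitive n \<alpha> ALG \<longrightarrow>
        (\<exists>ALGo :: nat policy.
           online_algorithm n ALGo \<and>
           (\<forall>\<rho>. ranking n \<rho> \<longrightarrow> success_prob n \<rho> ALGo \<ge> \<alpha> - C / real n) \<and>
           (\<exists>p. top_two_binary n p ALGo)))"
proof (intro exI[of _ 2] conjI allI impI)
  fix n \<alpha> and ALG :: "real list policy"
  assume n: "2 \<le> n" and ALG: "online_algorithm n ALG" "competitive n \<alpha> ALG"
  have "\<alpha> - 2 / real n \<le> opt_prob n"
  \<comment> \<open>A negative \<alpha> lies below \<open>opt_prob n\<close> already, as success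
    probabilities are nonnegative.\<close>
  proof (cases "0 \<le> \<alpha>")
    case True
    then show ?thesis
      using competitive_le_opt_prob[OF ALG True n] by simp
  next
    case False
    moreover have "0 \<le> opt_prob n" "0 \<le> 2 / real n"
      by (simp_all add: opt_prob_def opt_nonneg)
    ultimately show ?thesis
      by linarith
  qed
  then show "\<exists>ALGo :: nat policy. online_algorithm n ALGo \<and>
      (\<forall>\<rho>. ranking n \<rho> \<longrightarrow> success_prob n \<rho> ALGo \<ge> \<alpha> - 2 / real n) \<and>
      (\<exists>p. top_two_binary n p ALGo)"
    using n top_two_binary_threshold_policy[of n] success_prob_threshold_policy[of n]
    by (intro exI[of _ "threshold_policy n"])
      (auto simp: threshold_policy_def online_ordinal_policy)
qed simp

end
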